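(* Let $p$ be a prime, let $k\ge 1$ be an integer, and let $\mathcal{W}: y^2=x^3+ax+b$ with $a,b\in\mathbb{Z}_p$ be an elliptic curve in short Weierstrass form over $\mathbb{Q}_p$ whose reduction modulo $p$ is non-singular. Then the map $$\mathrm{Exp}\colon p\mathbb{Z}_p/p^k\mathbb{Z}_p\longrightarrow \mathcal{W}(\mathbb{Z}/p^k\mathbb{Z}),$$ defined through the Laurent series of the Weierstrass $\wp$-function and its derivative as in the context, is invertible on its image on the neighborhood of zero consisting of the classes of all $z\in\mathbb{Z}$ with $p\mid z$; that is, there is a map $\mathrm{Log}\colon \mathrm{Im}(\mathrm{Exp})\to p\mathbb{Z}_p/p^k\mathbb{Z}_p$ such that $\mathrm{Log}(\mathrm{Exp}(z))=z$ for all $z\in p\mathbb{Z}_p/p^k\mathbb{Z}_p$ and $\mathrm{Exp}(\mathrm{Log}(R))=R$ for all $R\in\mathrm{Im}(\mathrm{Exp})$.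
   Context: Points of the projective closure of $\mathcal{W}$ are written in homogeneous coordinates $[Z:X:Y]$, with $(x,y)=(X/Z,Y/Z)$ when $Z\neq 0$, and the point at infinity is $\Omega=[0:0:1]$. Points are identified with elements of the Jacobian through $R\mapsto R-\Omega$. $\mathcal{W}(\mathbb{Z}/p^k\mathbb{Z})$ is the group of points $[Z:X:Y]$ of the projective curve over $\mathbb{Z}/p^k\mathbb{Z}$, with at least one coordinate a unit, up to multiplication by units. A point of $\mathcal{W}(\mathbb{Q}_p)$ is reduced modulo $p^k$ by scaling its homogeneous coordinates so that they lie in $\mathbb{Z}_p$ with at least one of them a unit, and reducing each coordinate modulo $p^k$. Define the Laurent series $$\wp(z)=\frac1{z^2}+\sum_{l\ge 2}c_l z^{2l-2},\qquad \wp'(z)=-\frac{2}{z^3}+\sum_{l\ge 2}(2l-2)c_l z^{2l-3},$$ where $c_2=-\frac{a}{5}$, $c_3=-\frac{b}{7}$ and $c_l=\frac{3}{(2l+1)(l-3)}\sum_{s=2}^{l-2}c_sc_{l-s}$ for $l\ge 4$. These series converge for nonzero $z\in p\mathbb{Z}_p$, and $z\mapsto [1:\wp(z):\tfrac12\wp'(z)]$ for $z\ne 0$, $0\mapsto\Omega$, is a group homomorphism $p\mathbb{Z}_p\to\mathcal{W}(\mathbb{Q}_p)$. The map $\mathrm{Exp}\colon p\mathbb{Z}_p/p^k\mathbb{Z}_p\to\mathcal{W}(\mathbb{Z}/p^k\mathbb{Z})$ sends the class of $z$ to the reduction modulo $p^k$ of the image of $z$ under this homomorphism; this depends only on $z$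 modulo $p^k$. *)

theory Defs
  imports
    "HOL-Analysis.Analysis"
    "HOL-Algebra.Algebraic_Closure_Type"
    "Berlekamp_Zassenhaus.Finite_Field"
begin

section \<open>The $p$-adic integers\<close>

text \<open>The prime is carried by a type variable \<open>'p\<close> of sort \<open>prime_card\<close>, as \<open>p = CARD('p)\<close>.  An element of
  $\mathbb{Z}_p$ is a coherent family of canonical representatives modulo the powers of $p$.\<close>

typedef (overloaded) 'p::prime_card padic_int =
  "{x :: nat \<Rightarrow> int. \<forall>n. x n \<in> {0..<int CARD('p) ^ n} \<and> x (Suc n) mod int CARD('p) ^ n = x n}"
  morphisms padic_residue Abs_padic_int
  by (rule exI[of _ "\<lambda>_. 0"]) (simp add: prime_card prime_gt_0_nat)

setup_lifting type_definition_padic_int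

lemma card_gt_1: "int CARD('p::prime_card) > 1"
  using prime_gt_1_nat[OF prime_card[where 'a='p]] by simp

lemma card_pow_pos: "int CARD('p::prime_card) ^ n > 0"
  using card_gt_1[where 'p='p] by (intro zero_less_power) linarith

lemma mod_pow_Suc: "(x mod int CARD('p::prime_card) ^ Suc n) mod int CARD('p) ^ n = x mod int CARD('p) ^ n"
  by (intro mod_mod_cancel) simp

lemma padic_residue_mod_Suc: "padic_residue (x :: 'p::prime_card padic_int) (Suc n) mod int CARD('p) ^ n = padic_residue x n"
  using padic_residue[of x] by auto

lemma padic_residue_bounds:
  "0 \<le> padic_residue (x :: 'p::prime_card padic_int) n" "padic_residue x n < int CARD('p) ^ n"
  using padic_residue[of x] by auto

lemma padic_residue_mod_self [simp]:
  "padic_residue (x :: 'p::prime_card padic_int) n mod int CARD('p) ^ n = padic_residue x n"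
  by (intro mod_pos_pos_trivial padic_residue_bounds)

lemma padic_residue_mod:
  assumes "m \<le> n"
  shows "padic_residue (x :: 'p::prime_card padic_int) n mod int CARD('p) ^ m = padic_residue x m"
  using assms
proof (induction n rule: dec_induct)
  case (step n)
  have "padic_residue x (Suc n) mod int CARD('p) ^ m
      = (padic_residue x (Suc n) mod int CARD('p) ^ n) mod int CARD('p) ^ m"
    using step.hyps by (intro mod_mod_cancel[symmetric] le_imp_power_dvd)
  then show ?case using step.IH by (simp add: padic_residue_mod_Suc)
qed simp

lemma padic_int_eqI: "(\<And>n. padic_residue x n = padic_residue y n) \<Longrightarrow> x = y"
  by (simp add: padic_residue_inject[symmetric] fun_eq_iff)

lemma coherent_modI:
  assumes "f (Suc n) mod int CARD('p::prime_card) ^ n = f n mod int CARD('p) ^ n"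
  shows "f n mod int CARD('p) ^ n \<in> {0..<int CARD('p) ^ n} \<and>
    (f (Suc n) mod int CARD('p) ^ Suc n) mod int CARD('p) ^ n = f n mod int CARD('p) ^ n"
  using assms card_pow_pos[where 'p='p] by (auto simp only: mod_pow_Suc atLeastLessThan_iff pos_mod_sign pos_mod_bound)

instantiation padic_int :: (prime_card) comm_ring_1
begin

lift_definition zero_padic_int :: "'a padic_int" is "\<lambda>_. 0"
  using card_pow_pos[where 'p='a] by simp

lift_definition one_padic_int :: "'a padic_int" is "\<lambda>n. 1 mod int CARD('a) ^ n"
  by (rule coherent_modI) simp

lift_definition plus_padic_int :: "'a padic_int \<Rightarrow> 'a padic_int \<Rightarrow> 'a padic_int"
  is "\<lambda>x y n. (x n + y n) mod int CARD('a) ^ n"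
  by (rule coherent_modI) (metis mod_add_eq mod_mod_trivial)

lift_definition uminus_padic_int :: "'a padic_int \<Rightarrow> 'a padic_int"
  is "\<lambda>x n. (- x n) mod int CARD('a) ^ n"
  by (rule coherent_modI) (metis mod_minus_eq)

lift_definition minus_padic_int :: "'a padic_int \<Rightarrow> 'a padic_int \<Rightarrow> 'a padic_int"
  is "\<lambda>x y n. (x n - y n) mod int CARD('a) ^ n"
  by (rule coherent_modI) (metis mod_diff_eq mod_mod_trivial)

lift_definition times_padic_int :: "'a padic_int \<Rightarrow> 'a padic_int \<Rightarrow> 'a padic_int"
  is "\<lambda>x y n. (x n * y n) mod int CARD('a) ^ n"
  by (rule coherent_modI) (metis mod_mult_eq mod_mod_trivial)

instance
proof
  fix x y z :: "'a padic_int"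
  show "x * y * z = x * (y * z)" by (transfer, rule ext) (simp add: mod_simps mult.assoc)
  show "x * y = y * x" by transfer (simp add: mult.commute)
  show "1 * x = x"
    by (rule padic_int_eqI) (simp add: times_padic_int.rep_eq one_padic_int.rep_eq mod_simps)
  show "x + y + z = x + (y + z)" by (transfer, rule ext) (simp add: mod_simps add.assoc)
  show "x + y = y + x" by transfer (simp add: add.commute)
  show "0 + x = x" by (rule padic_int_eqI) (simp add: plus_padic_int.rep_eq zero_padic_int.rep_eq)
  show "- x + x = 0"
    by (rule padic_int_eqI)
       (simp add: plus_padic_int.rep_eq uminus_padic_int.rep_eq zero_padic_int.rep_eq mod_simps)
  show "x - y = x + - y"
    by (rule padic_int_eqI)
       (simp add: plus_padic_int.rep_eq uminus_padic_int.rep_eq minus_padic_int.rep_eq mod_simps)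
  show "(x + y) * z = x * z + y * z" by (transfer, rule ext) (simp add: mod_simps distrib_right)
  show "(0::'a padic_int) \<noteq> 1"
  proof
    assume "(0::'a padic_int) = 1"
    then have "padic_residue (0::'a padic_int) 1 = padic_residue 1 1" by simp
    then show False
      using card_gt_1[where 'p='a] by (simp add: zero_padic_int.rep_eq one_padic_int.rep_eq)
  qed
qed

end

lemma padic_residue_0 [simp]: "padic_residue 0 n = 0"
  by (simp add: zero_padic_int.rep_eq)

lemma padic_residue_add:
  "padic_residue (x + y :: 'p::prime_card padic_int) n = (padic_residue x n + padic_residue y n) mod int CARD('p) ^ n"
  by (simp add: plus_padic_int.rep_eq)

lemma padic_residue_mult:
  "padic_residue (x * y :: 'p::prime_card padic_int) n = (padic_residue x n * padic_residue y n) mod int CARD('p) ^ n"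
  by (simp add: times_padic_int.rep_eq)

lemma padic_residue_eq_0_mono:
  "m \<le> n \<Longrightarrow> padic_residue x n = 0 \<Longrightarrow> padic_residue x m = 0"
  using padic_residue_mod[of m n x] by simp

lemma padic_residue_eq_0_iff_dvd:
  assumes "m \<le> n"
  shows "padic_residue (x :: 'p::prime_card padic_int) m = 0 \<longleftrightarrow> int CARD('p) ^ m dvd padic_residue x n"
  using padic_residue_mod[OF assms, of x] by (simp add: dvd_eq_mod_eq_0)

lemma prime_power_dvd_mult_int:
  fixes a b q :: int
  assumes "Factorial_Ring.prime q" "\<not> q ^ Suc m dvd a" "\<not> q ^ Suc n dvd b"
  shows "\<not> q ^ Suc (m + n) dvd a * b"
proof -
  have "a \<noteq> 0" "b \<noteq> 0" using assms by auto
  moreover have "multiplicity q a \<le> m" "multiplicity q b \<le> n"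
    using assms(2,3) multiplicity_dvd'[of "Suc m" q a] multiplicity_dvd'[of "Suc n" q b]
    by (auto simp only: not_less_eq_eq[symmetric])
  ultimately show ?thesis
    using assms(1) by (subst power_dvd_iff_le_multiplicity)
      (auto simp: prime_elem_multiplicity_mult_distrib)
qed

lemma padic_residue_mult_neq_0:
  assumes "padic_residue (x :: 'p::prime_card padic_int) (Suc m) \<noteq> 0" "padic_residue y (Suc n) \<noteq> 0"
  shows "padic_residue (x * y) (Suc (m + n)) \<noteq> 0"
proof -
  have "\<not> int CARD('p) ^ Suc m dvd padic_residue x (Suc (m + n))"
       "\<not> int CARD('p) ^ Suc n dvd padic_residue y (Suc (m + n))"
    using assms padic_residue_eq_0_iff_dvd[of "Suc m" "Suc (m + n)" x]
          padic_residue_eq_0_iff_dvd[of "Suc n" "Suc (m + n)" y] by simp_all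
  then have "\<not> int CARD('p) ^ Suc (m + n) dvd padic_residue x (Suc (m + n)) * padic_residue y (Suc (m + n))"
    using prime_card[where 'a='p] by (intro prime_power_dvd_mult_int) auto
  then show ?thesis by (simp add: padic_residue_mult dvd_eq_mod_eq_0)
qed

lemma padic_residue_mult_eq_0:
  assumes "padic_residue (x :: 'p::prime_card padic_int) m = 0" "padic_residue y n = 0"
  shows "padic_residue (x * y) (m + n) = 0"
proof -
  have "int CARD('p) ^ m dvd padic_residue x (m + n)" "int CARD('p) ^ n dvd padic_residue y (m + n)"
    using assms padic_residue_eq_0_iff_dvd[of m "m + n" x] padic_residue_eq_0_iff_dvd[of n "m + n" y]
    by simp_all
  then have "int CARD('p) ^ (m + n) dvd padic_residue x (m + n) * padic_residue y (m + n)"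
    by (simp add: power_add mult_dvd_mono)
  then show ?thesis by (simp add: padic_residue_mult dvd_eq_mod_eq_0)
qed

lemma padic_int_neq_0_residue:
  assumes "(x :: 'p::prime_card padic_int) \<noteq> 0"
  obtains n where "padic_residue x n = 0" "padic_residue x (Suc n) \<noteq> 0"
proof -
  obtain m where m: "padic_residue x m \<noteq> 0"
    using assms padic_int_eqI[of x 0] by auto
  have "padic_residue x 0 = 0"
    using padic_residue_bounds[of x 0] by simp
  then show ?thesis
    using that m by (induction m) blast+
qed

instance padic_int :: (prime_card) idom
proof
  fix x y :: "'a padic_int"
  assume "x \<noteq> 0" "y \<noteq> 0"
  obtain m where "padic_residue x (Suc m) \<noteq> 0"
    using padic_int_neq_0_residue[OF \<open>x \<noteq> 0\<close>] .
  moreover obtain n where "padic_residue y (Suc n) \<noteq> 0"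
    using padic_int_neq_0_residue[OF \<open>y \<noteq> 0\<close>] .
  ultimately have "padic_residue (x * y) (Suc (m + n)) \<noteq> 0"
    by (rule padic_residue_mult_neq_0)
  then show "x * y \<noteq> 0" by auto
qed


section \<open>The field of $p$-adic numbers\<close>

text \<open>A non-archimedean absolute value on a domain extends to its field of fractions, which it makes
  a metric space.\<close>

class valued_idom = idom +
  fixes vabs :: "'a \<Rightarrow> real"
  assumes vabs_nonneg: "0 \<le> vabs x"
    and vabs_eq_0_iff [simp]: "vabs x = 0 \<longleftrightarrow> x = 0"
    and vabs_mult: "vabs (x * y) = vabs x * vabs y"
    and vabs_add_le_max: "vabs (x + y) \<le> max (vabs x) (vabs y)"

lemma vabs_1 [simp]: "vabs (1 :: 'a::valued_idom) = 1"
  using vabs_mult[of "1 :: 'a" 1] vabs_eq_0_iff[of "1 :: 'a"] by simp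

lemma vabs_minus: "vabs (- x :: 'a::valued_idom) = vabs x"
proof -
  have "(vabs (-1 :: 'a)) ^ 2 = 1"
    using vabs_mult[of "-1 :: 'a" "-1"] by (simp add: power2_eq_square)
  then have "vabs (-1 :: 'a) = 1"
    using vabs_nonneg[of "-1 :: 'a"] by (auto simp: power2_eq_1_iff)
  then show ?thesis using vabs_mult[of "-1" x] by simp
qed

definition fract_abs :: "'a::valued_idom fract \<Rightarrow> real"
  where "fract_abs q = (THE r. \<exists>a b. b \<noteq> 0 \<and> q = Fract a b \<and> r = vabs a / vabs b)"

lemma fract_abs_Fract:
  assumes "b \<noteq> 0"
  shows "fract_abs (Fract a b) = vabs a / vabs b"
  unfolding fract_abs_def
proof (rule the_equality)
  fix r assume "\<exists>c d. d \<noteq> 0 \<and> Fract a b = Fract c d \<and> r = vabs c / vabs d"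
  then show "r = vabs a / vabs b"
    using assms by (auto simp: eq_fract frac_eq_eq simp flip: vabs_mult)
qed (use assms in blast)

instantiation fract :: (valued_idom) metric_space
begin

definition dist_fract :: "'a fract \<Rightarrow> 'a fract \<Rightarrow> real"
  where "dist_fract q r = fract_abs (q - r)"

definition uniformity_fract :: "('a fract \<times> 'a fract) filter"
  where "uniformity_fract = (INF e\<in>{0<..}. principal {(x, y). dist x y < e})"

definition open_fract :: "'a fract set \<Rightarrow> bool"
  where "open_fract U \<longleftrightarrow> (\<forall>x\<in>U. \<forall>\<^sub>F (x', y) in uniformity. x' = x \<longrightarrow> y \<in> U)"

instance
proof
  have ultra: "fract_abs (q + r) \<le> max (fract_abs q) (fract_abs r)" for q r :: "'a fract"
  proof (cases q; cases r)
    fix a b c d :: 'a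
    assume q: "q = Fract a b" "b \<noteq> 0" and r: "r = Fract c d" "d \<noteq> 0"
    have pos: "vabs b > 0" "vabs d > 0"
      using q r vabs_nonneg[of b] vabs_nonneg[of d] by (simp_all add: less_le)
    have "vabs (a * d + c * b) \<le> max (vabs a * vabs d) (vabs c * vabs b)"
      using vabs_add_le_max[of "a * d" "c * b"] by (simp add: vabs_mult)
    also have "\<dots> = max (vabs a / vabs b) (vabs c / vabs d) * (vabs b * vabs d)"
      using pos q(2) r(2) by (simp add: max_mult_distrib_right)
    finally show ?thesis
      using q r pos by (simp add: fract_abs_Fract vabs_mult pos_divide_le_eq)
  qed
  have nonneg: "fract_abs q \<ge> 0" for q :: "'a fract"
    by (cases q) (simp add: fract_abs_Fract vabs_nonneg)
  have minus: "fract_abs (- q) = fract_abs q" for q :: "'a fract"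
    by (cases q) (simp add: fract_abs_Fract vabs_minus)
  fix x y z :: "'a fract"
  show "dist x y = 0 \<longleftrightarrow> x = y"
  proof -
    have "fract_abs q = 0 \<longleftrightarrow> q = 0" for q :: "'a fract"
      by (cases q) (simp add: fract_abs_Fract Zero_fract_def eq_fract)
    then show ?thesis by (simp add: dist_fract_def)
  qed
  show "dist x y \<le> dist x z + dist y z"
    using ultra[of "x - z" "z - y"] minus[of "y - z"] nonneg[of "x - z"] nonneg[of "y - z"]
    by (simp add: dist_fract_def)
qed (simp_all add: uniformity_fract_def open_fract_def)

end

instantiation padic_int :: (prime_card) valued_idom
begin

definition vabs_padic_int :: "'a padic_int \<Rightarrow> real"
  where "vabs_padic_int x =
    (if x = 0 then 0 else 1 / real CARD('a) ^ (LEAST n. padic_residue x (Suc n) \<noteq> 0))"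

instance
proof
  define v where "v x = (LEAST n. padic_residue x (Suc n) \<noteq> 0)" for x :: "'a padic_int"
  have vabs: "vabs x = (if x = 0 then 0 else 1 / real CARD('a) ^ v x)" for x :: "'a padic_int"
    by (simp add: vabs_padic_int_def v_def)
  have gt1: "real CARD('a) > 1"
    using card_gt_1[where 'p='a] by simp
  have v_eq: "v x = n" if "padic_residue x n = 0" "padic_residue x (Suc n) \<noteq> 0"
    for x :: "'a padic_int" and n
    unfolding v_def
  proof (rule Least_equality)
    fix m assume "padic_residue x (Suc m) \<noteq> 0"
    then show "n \<le> m" using that(1) padic_residue_eq_0_mono[of "Suc m" n x] by (auto simp: not_less_eq_eq[symmetric])
  qed (fact that(2))
  have v: "padic_residue x (v x) = 0" "padic_residue x (Suc (v x)) \<noteq> 0" if "x \<noteq> 0"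
    for x :: "'a padic_int"
  proof -
    obtain n where "padic_residue x n = 0" "padic_residue x (Suc n) \<noteq> 0"
      using padic_int_neq_0_residue[OF \<open>x \<noteq> 0\<close>] .
    then show "padic_residue x (v x) = 0" "padic_residue x (Suc (v x)) \<noteq> 0"
      using v_eq[of x n] by simp_all
  qed
  fix x y :: "'a padic_int"
  show "0 \<le> vabs x" by (simp add: vabs)
  show "vabs x = 0 \<longleftrightarrow> x = 0" using gt1 by (simp add: vabs)
  show "vabs (x * y) = vabs x * vabs y"
  proof (cases "x = 0 \<or> y = 0")
    case False
    then have "v (x * y) = v x + v y"
      by (intro v_eq padic_residue_mult_eq_0 padic_residue_mult_neq_0 v) auto
    with False show ?thesis by (simp add: vabs power_add)
  qed (auto simp: vabs)
  show "vabs (x + y) \<le> max (vabs x) (vabs y)"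
  proof (cases "x = 0 \<or> y = 0 \<or> x + y = 0")
    case True
    then show ?thesis by (auto simp: vabs le_max_iff_disj)
  next
    case False
    define m where "m = min (v x) (v y)"
    have "padic_residue x m = 0" "padic_residue y m = 0"
      using False padic_residue_eq_0_mono[of m _ x, OF _ v(1)] padic_residue_eq_0_mono[of m _ y, OF _ v(1)]
      by (simp_all add: m_def)
    then have "padic_residue (x + y) m = 0" by (simp add: padic_residue_add)
    then have "m \<le> v (x + y)"
      using False v(2)[of "x + y"] padic_residue_eq_0_mono[of "Suc (v (x + y))" m "x + y"]
      by (auto simp: not_less_eq_eq[symmetric])
    then have "1 / real CARD('a) ^ v (x + y) \<le> 1 / real CARD('a) ^ m"
      using gt1 by (intro divide_left_mono power_increasing) auto
    also have "\<dots> \<le> max (vabs x) (vabs y)"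
      using False by (auto simp: vabs m_def min_def)
    finally show ?thesis using False by (simp add: vabs)
  qed
qed

end

type_synonym 'p padic = "'p padic_int fract"


section \<open>Weierstrass curves\<close>

text \<open>\<open>X\<close> is reserved by the notation for univariate polynomials; free it for use as a coordinate.\<close>

no_notation Polynomials.var ("X\<index>")

text \<open>Smoothness of $Y^2Z = X^3 + aXZ^2 + bZ^3$ by the Jacobian criterion at all geometric points.
  In characteristic 2 it fails for all \<open>a\<close> and \<open>b\<close>.\<close>

definition nonsingular_weierstrass :: "'k::field \<Rightarrow> 'k \<Rightarrow> bool"
  where "nonsingular_weierstrass a b \<longleftrightarrow>
    \<not> (\<exists>Z X Y :: 'k alg_closure. (Z, X, Y) \<noteq> (0, 0, 0) \<and>
        Y ^ 2 * Z - X ^ 3 - to_ac a * X * Z ^ 2 - to_ac b * Z ^ 3 = 0 \<and>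
        Y ^ 2 - 2 * to_ac a * X * Z - 3 * to_ac b * Z ^ 2 = 0 \<and>
        - 3 * X ^ 2 - to_ac a * Z ^ 2 = 0 \<and>
        2 * Y * Z = 0)"

definition reduce_mod_p :: "'p::prime_card padic_int \<Rightarrow> 'p mod_ring"
  where "reduce_mod_p x = of_int (padic_residue x 1)"

text \<open>The point $[Z:X:Y]$ is the set of all its homogeneous coordinate triples.\<close>

definition proj_point :: "'r ring \<Rightarrow> 'r \<times> 'r \<times> 'r \<Rightarrow> ('r \<times> 'r \<times> 'r) set"
  where "proj_point R = (\<lambda>(Z, X, Y). {(u \<otimes>\<^bsub>R\<^esub> Z, u \<otimes>\<^bsub>R\<^esub> X, u \<otimes>\<^bsub>R\<^esub> Y) | u. u \<in> Units R})"

definition weierstrass_points :: "'r ring \<Rightarrow> 'r \<Rightarrow> 'r \<Rightarrow> ('r \<times> 'r \<times> 'r) set set"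
  where "weierstrass_points R a b =
    {proj_point R (Z, X, Y) | Z X Y.
       Z \<in> carrier R \<and> X \<in> carrier R \<and> Y \<in> carrier R \<and>
       (Z \<in> Units R \<or> X \<in> Units R \<or> Y \<in> Units R) \<and>
       Y [^]\<^bsub>R\<^esub> (2::nat) \<otimes>\<^bsub>R\<^esub> Z =
         X [^]\<^bsub>R\<^esub> (3::nat) \<oplus>\<^bsub>R\<^esub> a \<otimes>\<^bsub>R\<^esub> X \<otimes>\<^bsub>R\<^esub> Z [^]\<^bsub>R\<^esub> (2::nat) \<oplus>\<^bsub>R\<^esub> b \<otimes>\<^bsub>R\<^esub> Z [^]\<^bsub>R\<^esub> (3::nat)}"

text \<open>All admissible scalings of a point have the same reduction, so the set below is a singleton
  for every point of the projective plane over $\mathbb{Q}_p$.\<close>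

definition reduce_point ::
    "nat \<Rightarrow> ('p::prime_card padic \<times> 'p padic \<times> 'p padic) set \<Rightarrow> (int \<times> int \<times> int) set"
  where "reduce_point k P = the_elem
    {proj_point (residue_ring (int CARD('p) ^ k))
       (padic_residue Z k, padic_residue X k, padic_residue Y k) | Z X Y.
       (to_fract Z, to_fract X, to_fract Y) \<in> P \<and> (Z dvd 1 \<or> X dvd 1 \<or> Y dvd 1)}"


section \<open>The exponential\<close>

function wp_coeff :: "'k::field \<Rightarrow> 'k \<Rightarrow> nat \<Rightarrow> 'k"
  where "wp_coeff a b l =
    (if l < 2 then 0
     else if l = 2 then - a / 5
     else if l = 3 then - b / 7
     else 3 / of_nat ((2 * l + 1) * (l - 3)) * (\<Sum>s = 2..l - 2. wp_coeff a b s * wp_coeff a b (l - s)))"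
  by auto
termination
  by (relation "Wellfounded.measure (\<lambda>(a, b, l). l)") auto

declare wp_coeff.simps [simp del]

text \<open>In the two series the index \<open>l\<close> is shifted so that it starts at 0.\<close>

definition wp :: "'p::prime_card padic \<Rightarrow> 'p padic \<Rightarrow> 'p padic \<Rightarrow> 'p padic"
  where "wp a b z = 1 / z ^ 2 + (\<Sum>l. wp_coeff a b (l + 2) * z ^ (2 * (l + 2) - 2))"

definition wp' :: "'p::prime_card padic \<Rightarrow> 'p padic \<Rightarrow> 'p padic \<Rightarrow> 'p padic"
  where "wp' a b z = - 2 / z ^ 3 +
    (\<Sum>l. of_nat (2 * (l + 2) - 2) * wp_coeff a b (l + 2) * z ^ (2 * (l + 2) - 3))"

definition exp_point ::
    "'p::prime_card padic_int \<Rightarrow> 'p padic_int \<Rightarrow> 'p padic_int \<Rightarrow> ('p padic \<times> 'p padic \<times> 'p padic) set"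
  where "exp_point a b z = proj_point ring_of_type_algebra
    (if z = 0 then (0, 0, 1)
     else (1, wp (to_fract a) (to_fract b) (to_fract z),
              1 / 2 * wp' (to_fract a) (to_fract b) (to_fract z)))"

text \<open>$p\mathbb{Z}_p/p^k\mathbb{Z}_p$, as the set of the cosets $z + p^k\mathbb{Z}_p$ with $p \mid z$\<close>

definition pZp_quotient :: "nat \<Rightarrow> 'p::prime_card padic_int set set"
  where "pZp_quotient k =
    {z. of_nat CARD('p) dvd z} // {(x, y). of_nat CARD('p) ^ k dvd x - y}"

text \<open>The value on a coset is the common value on its representatives.\<close>

definition Exp ::
    "'p::prime_card padic_int \<Rightarrow> 'p padic_int \<Rightarrow> nat \<Rightarrow> 'p padic_int set \<Rightarrow> (int \<times> int \<times> int) set"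
  where "Exp a b k C = the_elem ((\<lambda>z. reduce_point k (exp_point a b z)) ` C)"

end

theory Submission
  imports Defs
begin

text \<open>Near the point at infinity the curve is described by the coordinates \<open>t = - x / y\<close> and
  \<open>w = - 1 / y\<close>, in which a point is \<open>[w : t : - 1]\<close>, the point \<open>\<Omega>\<close> is \<open>t = w = 0\<close>, and the equation reads
  \<open>w = t\<^sup>3 + a t w\<^sup>2 + b w\<^sup>3\<close>. Inserting the series \<open>x = \<wp>(z)\<close>, \<open>y = \<wp>'(z) / 2\<close> turns the exponential into
  \<open>z \<mapsto> [w(z) : t(z) : - 1]\<close>, also at \<open>z = 0\<close>, with \<open>t(z)\<close> and \<open>w(z)\<close> in \<open>p\<int>\<^sub>p\<close>
  (\<open>exp_point_coordinates\<close>). As the last coordinate is a unit, the reduction of this point modulo \<open>p\<^sup>k\<close>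
  is the same information as \<open>t(z)\<close> and \<open>w(z)\<close> modulo \<open>p\<^sup>k\<close>, and modulo \<open>p\<^sup>k\<close> the equation determines
  \<open>w\<close> from \<open>t\<close> (\<open>curve_congruence\<close>). So \<open>Exp\<close> is well defined on classes and injective once
  \<open>\<bar>t(z) - t(z')\<bar> = \<bar>z - z'\<bar>\<close> on \<open>p\<int>\<^sub>p\<close> (\<open>exp_coordinate_isometry\<close>), and \<open>Log\<close> is its inverse on the image.

  The isometry holds because \<open>t(z) = z + \<dots>\<close> and the higher coefficients of \<open>t\<close> are not too large. The recursion for
  the \<open>c\<^sub>l\<close> is the differential equation \<open>\<wp>'' = 6 \<wp>\<^sup>2 + 2 a\<close>, whose first integral is the Weierstrass equation
  (\<open>wp_scaled_weierstrass\<close>). In the coordinates \<open>t\<close>, \<open>w\<close> it becomes the Hamiltonian system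
  \<open>t' = \<partial>E/\<partial>w\<close>, \<open>w' = - \<partial>E/\<partial>t\<close> of \<open>E = w - t\<^sup>3 - a t w\<^sup>2 - b w\<^sup>3\<close> (\<open>hamiltonian_system\<close>). It has integral
  coefficients and the solution starts at the origin, so all derivatives of \<open>t\<close> at \<open>0\<close> are
  integral: \<open>n! t\<^sub>n \<in> \<int>\<^sub>p\<close> (\<open>hurwitz_of_hamiltonian_system\<close>). For \<open>p \<ge> 3\<close> the exponent of \<open>p\<close> in \<open>n!\<close> is at most
  \<open>(n - 1) / 2\<close> (\<open>twice_multiplicity_fact_le\<close>), whence \<open>\<bar>t\<^sub>n\<bar> \<le> p\<^bsup>(n - 1) / 2\<^esup>\<close>, which \<open>\<bar>z\<bar> \<le> 1 / p\<close> beats. The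
  prime 2 does not occur, because a short Weierstrass equation is singular in characteristic 2.

  The denominators in the recursion accumulate, so the size of the \<open>c\<^sub>l\<close> is not read off from it. It comes
  from the bound on \<open>t\<close>: the equation of the curve transports the bound to \<open>w\<close> (\<open>growth_of_curve\<close>), and
  \<open>z\<^sup>2 \<wp>\<close> and \<open>z\<^sup>3 \<wp>' / 2\<close> are quotients of series with that bound by a series of constant term 1
  (\<open>growth_divisor\<close>). Series with this bound can be evaluated on \<open>p\<int>\<^sub>p\<close>, compatibly with sums and
  products (\<open>evaluates_to_mult\<close>), so every identity of formal series gives an identity of \<open>p\<close>-adic numbers.\<close>

section \<open>The Weierstrass differential equation for formal series\<close>

text \<open>The part \<open>\<wp>(z) - 1 / z\<^sup>2\<close>; the exponent \<open>2 l - 2\<close> carries \<open>c\<^sub>l\<close>.\<close>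

definition wp_regular :: "'a::field_char_0 \<Rightarrow> 'a \<Rightarrow> 'a fps"
  where "wp_regular a b = Abs_fps (\<lambda>n. if even n then wp_coeff a b (n div 2 + 1) else 0)"

text \<open>The power series \<open>z\<^sup>2 \<wp>(z)\<close> and \<open>z\<^sup>3 \<wp>'(z) / 2\<close>, which allow the Laurent series to be handled among
  power series.\<close>

definition wp_scaled :: "'a::field_char_0 \<Rightarrow> 'a \<Rightarrow> 'a fps"
  where "wp_scaled a b = 1 + fps_X ^ 2 * wp_regular a b"

definition wp'_scaled :: "'a::field_char_0 \<Rightarrow> 'a \<Rightarrow> 'a fps"
  where "wp'_scaled a b = - 1 + fps_const (1 / 2) * fps_X ^ 3 * fps_deriv (wp_regular a b)"

lemma wp_coeff_small: "wp_coeff a b 0 = 0" "wp_coeff a b (Suc 0) = 0"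
  "wp_coeff a b 2 = - a / 5" "wp_coeff a b 3 = - b / 7"
  "wp_coeff a b (Suc (Suc 0)) = - a / 5" "wp_coeff a b (Suc (Suc (Suc 0))) = - b / 7"
  by (subst wp_coeff.simps; simp)+

text \<open>With \<open>l = j + 2\<close>, and multiplied out, the defining clauses of \<open>wp_coeff\<close> become one
  relation. At \<open>j = 1\<close> it reads \<open>0 = 0\<close>: the equation of second order leaves \<open>c\<^sub>3\<close> free, as the
  constant \<open>b\<close> is lost by differentiation.\<close>

lemma wp_coeff_recurrence:
  fixes a b :: "'a::field_char_0"
  shows "of_nat (2 * j + 5) * (of_nat j - 1) * wp_coeff a b (j + 2) =
    3 * (\<Sum>s = 2..j. wp_coeff a b s * wp_coeff a b (j + 2 - s)) + (if j = 0 then a else 0)"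
proof -
  consider "j = 0" | "j = 1" | i where "j = i + 2"
    by (metis One_nat_def add_2_eq_Suc' not0_implies_Suc)
  then show ?thesis
  proof cases
    case 3
    have "of_nat (2 * i + 9) \<noteq> (0 :: 'a)" "of_nat (i + 1) \<noteq> (0 :: 'a)"
      by (simp_all only: of_nat_eq_0_iff)
    moreover have "wp_coeff a b (j + 2) = 3 / of_nat ((2 * i + 9) * (i + 1)) *
        (\<Sum>s = 2..j. wp_coeff a b s * wp_coeff a b (j + 2 - s))"
      using 3 by (subst wp_coeff.simps) (simp add: eval_nat_numeral)
    ultimately have "of_nat (2 * i + 9) * of_nat (i + 1) * wp_coeff a b (j + 2) =
        3 * (\<Sum>s = 2..j. wp_coeff a b s * wp_coeff a b (j + 2 - s))"
      by (simp only: of_nat_mult) simp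
    then show ?thesis
      using 3 by (simp add: algebra_simps)
  qed (simp_all add: wp_coeff_small)
qed

lemma wp_regular_nth_even: "fps_nth (wp_regular a b) (2 * r) = wp_coeff a b (r + 1)"
  by (simp add: wp_regular_def)

lemma wp_regular_nth_odd: "odd n \<Longrightarrow> fps_nth (wp_regular a b) n = 0"
  by (simp add: wp_regular_def)

lemma wp_regular_square_nth:
  fixes a b :: "'a::field_char_0"
  shows "fps_nth (wp_regular a b ^ 2) (2 * j) = (\<Sum>s = 2..j. wp_coeff a b s * wp_coeff a b (j + 2 - s))"
proof -
  let ?C = "fps_nth (wp_regular a b)"
  have "fps_nth (wp_regular a b ^ 2) (2 * j) = (\<Sum>i = 0..2 * j. ?C i * ?C (2 * j - i))"
    by (simp add: power2_eq_square fps_mult_nth)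
  also have "\<dots> = (\<Sum>i \<in> (*) 2 ` {0..j}. ?C i * ?C (2 * j - i))"
  proof (rule sum.mono_neutral_right)
    show "\<forall>i\<in>{0..2 * j} - (*) 2 ` {0..j}. ?C i * ?C (2 * j - i) = 0"
    proof
      fix i assume "i \<in> {0..2 * j} - (*) 2 ` {0..j}"
      then have "odd i" by (auto elim!: evenE)
      then show "?C i * ?C (2 * j - i) = 0" by (simp add: wp_regular_nth_odd)
    qed
  qed auto
  also have "\<dots> = (\<Sum>r = 0..j. wp_coeff a b (r + 1) * wp_coeff a b (j - r + 1))"
    by (subst sum.reindex)
       (auto simp: inj_on_def wp_regular_nth_even simp flip: diff_mult_distrib2 intro!: sum.cong)
  also have "\<dots> = (\<Sum>s = Suc 0..Suc j. wp_coeff a b s * wp_coeff a b (j + 2 - s))"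
    by (subst sum.atLeast_Suc_atMost_Suc_shift) (auto intro!: sum.cong simp: Suc_diff_le)
  also have "\<dots> = (\<Sum>s = 2..j. wp_coeff a b s * wp_coeff a b (j + 2 - s))"
  proof (rule sum.mono_neutral_right)
    show "\<forall>s\<in>{Suc 0..Suc j} - {2..j}. wp_coeff a b s * wp_coeff a b (j + 2 - s) = 0"
    proof
      fix s assume "s \<in> {Suc 0..Suc j} - {2..j}"
      then have "s = Suc 0 \<or> s = Suc j" by auto
      then show "wp_coeff a b s * wp_coeff a b (j + 2 - s) = 0" by (auto simp: wp_coeff_small)
    qed
  qed auto
  finally show ?thesis .
qed

text \<open>The equation \<open>\<wp>'' = 6 \<wp>\<^sup>2 + 2 a\<close> with the polar parts removed: \<open>1 / z\<^sup>2\<close> contributes \<open>6 / z\<^sup>4\<close> on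
  both sides, and the mixed term of the square contributes \<open>12 C / z\<^sup>2\<close>.\<close>

lemma wp_regular_second_derivative:
  fixes a b :: "'a::field_char_0"
  shows "fps_X ^ 2 * fps_deriv (fps_deriv (wp_regular a b)) =
    12 * wp_regular a b + fps_X ^ 2 * (6 * wp_regular a b ^ 2 + 2 * fps_const a)"
proof (rule fps_ext)
  fix n :: nat
  let ?C = "wp_regular a b"
  let ?L = "fps_X ^ 2 * fps_deriv (fps_deriv ?C)"
  let ?R = "12 * ?C + fps_X ^ 2 * (6 * ?C ^ 2 + 2 * fps_const a)"
  have num: "fps_nth (numeral k * f) m = numeral k * fps_nth f m" for k m and f :: "'a fps"
    by (simp add: numeral_fps_const)
  have const: "2 * fps_const a = fps_const (2 * a)"
    by (simp add: numeral_fps_const)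
  consider "n = 0" | "n = 1" | m where "n = m + 2"
    by (metis One_nat_def add_2_eq_Suc' not0_implies_Suc)
  then show "fps_nth ?L n = fps_nth ?R n"
  proof cases
    case 1
    then show ?thesis
      using wp_regular_nth_even[of a b 0] by (simp add: num fps_X_power_mult_nth wp_coeff_small)
  next
    case 2
    then have "fps_nth (f * ?C) n = fps_nth f 0 * fps_nth ?C 1 + fps_nth f 1 * fps_nth ?C 0" for f
      by simp
    then have "fps_nth (12 * ?C) n = 0"
      using wp_regular_nth_even[of a b 0] by (simp add: wp_coeff_small wp_regular_nth_odd)
    then show ?thesis
      using 2 by (simp only: fps_add_nth) (simp add: fps_X_power_mult_nth)
  next
    case 3
    have L: "fps_nth ?L n = of_nat (m + 1) * of_nat (m + 2) * fps_nth ?C (m + 2)"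
      unfolding 3 by (simp add: fps_X_power_mult_nth)
    have R: "fps_nth ?R n = 12 * fps_nth ?C (m + 2) + 6 * fps_nth (?C ^ 2) m + (if m = 0 then 2 * a else 0)"
      unfolding 3 const by (simp add: fps_X_power_mult_nth num)
    show ?thesis
    proof (cases "even m")
      case False
      have "fps_nth (?C ^ 2) m = 0"
        unfolding power2_eq_square fps_mult_nth
      proof (intro sum.neutral ballI)
        fix i assume "i \<in> {0..m}"
        then show "fps_nth ?C i * fps_nth ?C (m - i) = 0"
          using False by (cases "odd i") (simp_all add: wp_regular_nth_odd)
      qed
      then show ?thesis using False unfolding L R by (auto simp: wp_regular_nth_odd)
    next
      case True
      then obtain j where j: "m = 2 * j" by blast
      have "fps_nth ?C (m + 2) = wp_coeff a b (j + 2)"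
        using wp_regular_nth_even[of a b "j + 1"] j by simp
      then show ?thesis
        using arg_cong[OF wp_coeff_recurrence[of j a b], of "\<lambda>x. 2 * x"] unfolding L R j wp_regular_square_nth
        by (simp add: algebra_simps split: if_splits)
    qed
  qed
qed

lemma wp_scaled_derivative: "fps_X * fps_deriv (wp_scaled a b) = 2 * wp_scaled a b + 2 * wp'_scaled a b"
proof -
  have "2 * fps_const (1 / 2 :: 'a) = 1"
    by (simp add: numeral_fps_const)
  then have h: "2 * (fps_const (1 / 2 :: 'a) * f) = f" for f
    by (metis mult.assoc mult_1)
  show ?thesis
    by (simp add: wp_scaled_def wp'_scaled_def fps_deriv_power h algebra_simps power2_eq_square power3_eq_cube)
qed

text \<open>The polynomial identities behind \<open>wp'_scaled_derivative\<close> and \<open>wp_scaled_weierstrass\<close> are stated for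
  elements of a commutative ring, because the simplifier would unfold the derivatives of concrete series.\<close>

lemma second_derivative_polynomial_identity:
  fixes h z d C c :: "'a::comm_ring_1"
  assumes "2 * h = 1"
  shows "h * (3 * z ^ 3 * d) + h * (z ^ 2 * (12 * C + z ^ 2 * (6 * C ^ 2 + 2 * c))) =
      3 * (- 1 + h * z ^ 3 * d) + 3 * (1 + z ^ 2 * C) ^ 2 + c * z ^ 4"
proof -
  have "h * (3 * z ^ 3 * d) + h * (z ^ 2 * (12 * C + z ^ 2 * (6 * C ^ 2 + 2 * c)))
     = h * (3 * z ^ 3 * d) + (2 * h) * (z ^ 2 * (6 * C + z ^ 2 * (3 * C ^ 2 + c)))"
    by (simp add: algebra_simps)
  also have "\<dots> = 3 * (- 1 + h * z ^ 3 * d) + 3 * (1 + z ^ 2 * C) ^ 2 + c * z ^ 4"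
    unfolding assms by (simp add: algebra_simps eval_nat_numeral)
  finally show ?thesis .
qed

lemma first_integral_polynomial_identity:
  fixes p q p' q' x a b y y' z z' :: "'a::comm_ring_1"
  assumes "x * p' = 2 * p + 2 * q" and "x * q' = 3 * q + 3 * p ^ 2 + a * z"
    and "x * z' = 4 * z" and "x * y' = 6 * y"
  shows "x * (2 * q * q' - 3 * p ^ 2 * p' - a * (z' * p + z * p') - b * y') =
    6 * (q ^ 2 - p ^ 3 - a * z * p - b * y)"
proof -
  have "x * (2 * q * q' - 3 * p ^ 2 * p' - a * (z' * p + z * p') - b * y') =
      2 * q * (x * q') - 3 * p ^ 2 * (x * p') - a * ((x * z') * p + z * (x * p')) - b * (x * y')"
    by (simp add: algebra_simps)
  also have "\<dots> = 6 * (q ^ 2 - p ^ 3 - a * z * p - b * y)"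
    unfolding assms by (simp add: algebra_simps power2_eq_square power3_eq_cube)
  finally show ?thesis .
qed

lemma wp'_scaled_derivative:
  "fps_X * fps_deriv (wp'_scaled a b) = 3 * wp'_scaled a b + 3 * wp_scaled a b ^ 2 + fps_const a * fps_X ^ 4"
proof -
  let ?C = "wp_regular a b" and ?h = "fps_const (1 / 2 :: 'a)"
  have h: "2 * ?h = 1"
    by (simp add: numeral_fps_const)
  have d: "fps_deriv (fps_X ^ 3 :: 'a fps) = 3 * fps_X ^ 2"
    by (simp add: fps_deriv_power numeral_fps_const)
  have "fps_X * fps_deriv (wp'_scaled a b) = ?h * (3 * fps_X ^ 3 * fps_deriv ?C) +
      ?h * (fps_X ^ 2 * (fps_X ^ 2 * fps_deriv (fps_deriv ?C)))"
    by (simp add: wp'_scaled_def d algebra_simps power2_eq_square power3_eq_cube)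
  also have "\<dots> = 3 * wp'_scaled a b + 3 * wp_scaled a b ^ 2 + fps_const a * fps_X ^ 4"
    unfolding wp_regular_second_derivative wp'_scaled_def wp_scaled_def by (rule second_derivative_polynomial_identity[OF h])
  finally show ?thesis .
qed

text \<open>The Euler operator \<open>z d/dz\<close> multiplies the coefficient of \<open>z\<^sup>n\<close> by \<open>n\<close>, so an eigenvector for \<open>k\<close> is a
  multiple of \<open>z\<^sup>k\<close>.\<close>

lemma fps_nth_eq_0_of_euler_eigen:
  fixes G :: "'a::field_char_0 fps"
  assumes "fps_X * fps_deriv G = of_nat k * G" and "n \<noteq> k"
  shows "fps_nth G n = 0"
proof -
  have "fps_nth (fps_X * fps_deriv G) n = of_nat n * fps_nth G n"
    by (cases n) simp_all
  moreover have "fps_nth (of_nat k * G) n = of_nat k * fps_nth G n"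
    by (simp add: fps_of_nat[symmetric])
  ultimately have "of_nat n * fps_nth G n = of_nat k * fps_nth G n"
    using assms(1) by metis
  then show ?thesis using assms(2) by auto
qed

text \<open>The difference of the two sides of \<open>(\<wp>' / 2)\<^sup>2 = \<wp>\<^sup>3 + a \<wp> + b\<close> has derivative zero by the equation of second
  order, hence is a constant, and the choice \<open>c\<^sub>3 = - b / 7\<close> makes the constant vanish. After multiplication
  by \<open>z\<^sup>6\<close> a constant is an eigenvector of \<open>z d/dz\<close> for the eigenvalue 6, so only the coefficient of
  \<open>z\<^sup>6\<close> has to be computed.\<close>

lemma wp_scaled_weierstrass:
  "wp'_scaled a b ^ 2 = wp_scaled a b ^ 3 + fps_const a * fps_X ^ 4 * wp_scaled a b + fps_const b * fps_X ^ 6"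
proof -
  let ?P = "wp_scaled a b" and ?Q = "wp'_scaled a b"
  define G where "G = ?Q ^ 2 - ?P ^ 3 - fps_const a * fps_X ^ 4 * ?P - fps_const b * fps_X ^ 6"
  have d4: "fps_X * fps_deriv (fps_X ^ 4 :: 'a fps) = 4 * fps_X ^ 4"
    by (simp add: fps_deriv_power numeral_fps_const eval_nat_numeral)
  have d6: "fps_X * fps_deriv (fps_X ^ 6 :: 'a fps) = 6 * fps_X ^ 6"
    by (simp add: fps_deriv_power numeral_fps_const eval_nat_numeral)
  have d2: "fps_deriv (?Q ^ 2) = 2 * ?Q * fps_deriv ?Q"
    by (simp add: power2_eq_square algebra_simps)
  have d3: "fps_deriv (?P ^ 3) = 3 * ?P ^ 2 * fps_deriv ?P"
    by (simp add: power2_eq_square power3_eq_cube algebra_simps)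
  have "fps_X * fps_deriv G = fps_X * (2 * ?Q * fps_deriv ?Q - 3 * ?P ^ 2 * fps_deriv ?P
      - fps_const a * (fps_deriv (fps_X ^ 4) * ?P + fps_X ^ 4 * fps_deriv ?P)
      - fps_const b * fps_deriv (fps_X ^ 6))"
    unfolding G_def fps_deriv_sub d2 d3 mult.assoc fps_deriv_mult fps_deriv_const
    by (simp only: mult_zero_left add_0_right add_0_left mult.assoc add.commute)
  also have "\<dots> = of_nat 6 * G"
    unfolding G_def of_nat_numeral
    by (rule first_integral_polynomial_identity[OF wp_scaled_derivative wp'_scaled_derivative d4 d6])
  finally have eigen: "fps_X * fps_deriv G = of_nat 6 * G" .
  have C: "fps_nth (wp_regular a b) 0 = 0" "fps_nth (wp_regular a b) (Suc 0) = 0"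
      "fps_nth (wp_regular a b) 2 = - a / 5" "fps_nth (wp_regular a b) 4 = - b / 7" "fps_nth (wp_regular a b) 3 = 0"
      "fps_nth (wp_regular a b) (Suc (Suc 0)) = - a / 5"
    by (simp_all add: wp_regular_def wp_coeff_small)
  have P: "fps_nth ?P 0 = 1" "fps_nth ?P 1 = 0" "fps_nth ?P 2 = 0" "fps_nth ?P 3 = 0"
      "fps_nth ?P 4 = - a / 5" "fps_nth ?P 5 = 0" "fps_nth ?P 6 = - b / 7"
    using C by (simp_all add: wp_scaled_def fps_X_power_mult_nth)
  have Q: "fps_nth ?Q 0 = - 1" "fps_nth ?Q 1 = 0" "fps_nth ?Q 2 = 0" "fps_nth ?Q 3 = 0"
      "fps_nth ?Q 4 = - a / 5" "fps_nth ?Q 5 = 0" "fps_nth ?Q 6 = - 2 * b / 7"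
    using C by (simp_all add: wp'_scaled_def fps_X_power_mult_nth mult.assoc)
  have m: "fps_nth (f * g) 6 = fps_nth f 0 * fps_nth g 6 + fps_nth f 1 * fps_nth g 5 + fps_nth f 2 * fps_nth g 4
      + fps_nth f 3 * fps_nth g 3 + fps_nth f 4 * fps_nth g 2 + fps_nth f 5 * fps_nth g 1 + fps_nth f 6 * fps_nth g 0"
      "fps_nth (f * g) 0 = fps_nth f 0 * fps_nth g 0"
      "fps_nth (f * g) 2 = fps_nth f 0 * fps_nth g 2 + fps_nth f 1 * fps_nth g 1 + fps_nth f 2 * fps_nth g 0"
    for f g :: "'a fps"
  proof -
    have "{0..6::nat} = {0, 1, 2, 3, 4, 5, 6}" "{0..2::nat} = {0, 1, 2}"
      by auto
    then show "fps_nth (f * g) 6 = fps_nth f 0 * fps_nth g 6 + fps_nth f 1 * fps_nth g 5 + fps_nth f 2 * fps_nth g 4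
      + fps_nth f 3 * fps_nth g 3 + fps_nth f 4 * fps_nth g 2 + fps_nth f 5 * fps_nth g 1 + fps_nth f 6 * fps_nth g 0"
      "fps_nth (f * g) 2 = fps_nth f 0 * fps_nth g 2 + fps_nth f 1 * fps_nth g 1 + fps_nth f 2 * fps_nth g 0"
      by (simp_all add: fps_mult_nth)
  qed simp
  have "fps_nth G 6 = 0"
    using P Q by (simp add: G_def power3_eq_cube power2_eq_square m fps_X_power_mult_nth mult.assoc)
  then have "G = 0"
    using fps_nth_eq_0_of_euler_eigen[OF eigen] by (intro fps_ext) (metis \<open>fps_nth G 6 = 0\<close> fps_zero_nth)
  then show ?thesis by (simp add: G_def algebra_simps)
qed


text \<open>The series \<open>w / z\<^sup>3\<close> and \<open>t / z\<close> for \<open>w = - 1 / y\<close> and \<open>t = - x / y\<close>; both have constant term 1.\<close>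

definition w_scaled :: "'a::field_char_0 \<Rightarrow> 'a \<Rightarrow> 'a fps"
  where "w_scaled a b = - inverse (wp'_scaled a b)"

definition t_scaled :: "'a::field_char_0 \<Rightarrow> 'a \<Rightarrow> 'a fps"
  where "t_scaled a b = wp_scaled a b * w_scaled a b"

lemma wp'_scaled_times_w_scaled: "wp'_scaled a b * w_scaled a b = - 1"
proof -
  have "fps_nth (wp'_scaled a b) 0 \<noteq> 0" by (simp add: wp'_scaled_def)
  then have "inverse (wp'_scaled a b) * wp'_scaled a b = 1"
    by (rule inverse_mult_eq_1)
  then show ?thesis by (simp add: w_scaled_def mult.commute)
qed

lemma w_scaled_nth_0: "fps_nth (w_scaled a b) 0 = 1"
  using arg_cong[OF wp'_scaled_times_w_scaled[of a b], of "\<lambda>f. fps_nth f 0"] by (simp add: wp'_scaled_def)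

lemma t_scaled_nth_0: "fps_nth (t_scaled a b) 0 = 1"
  by (simp add: t_scaled_def w_scaled_nth_0 wp_scaled_def)

text \<open>The Weierstrass equation divided by \<open>- y\<^sup>3\<close>.\<close>

lemma w_scaled_curve:
  "w_scaled a b = t_scaled a b ^ 3 + fps_const a * fps_X ^ 4 * (t_scaled a b * w_scaled a b ^ 2)
     + fps_const b * fps_X ^ 6 * w_scaled a b ^ 3"
proof -
  let ?Q = "wp'_scaled a b" and ?P = "wp_scaled a b" and ?W = "w_scaled a b"
  have "?W = (?Q * ?W) ^ 2 * ?W"
    by (simp add: wp'_scaled_times_w_scaled)
  also have "\<dots> = ?Q ^ 2 * ?W ^ 3"
    by (simp add: power2_eq_square power3_eq_cube)
  also have "\<dots> = (?P * ?W) ^ 3 + fps_const a * fps_X ^ 4 * ((?P * ?W) * ?W ^ 2) + fps_const b * fps_X ^ 6 * ?W ^ 3"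
    unfolding wp_scaled_weierstrass by (simp add: algebra_simps power2_eq_square power3_eq_cube)
  finally show ?thesis by (simp add: t_scaled_def)
qed

lemma w_scaled_derivative:
  "fps_X * fps_deriv (w_scaled a b) = - 3 * w_scaled a b + 3 * t_scaled a b ^ 2 + fps_const a * fps_X ^ 4 * w_scaled a b ^ 2"
proof -
  let ?Q = "wp'_scaled a b" and ?P = "wp_scaled a b" and ?W = "w_scaled a b"
  have "fps_deriv (?Q * ?W) = 0"
    by (simp add: wp'_scaled_times_w_scaled)
  then have "fps_X * ?W * (?Q * fps_deriv ?W + fps_deriv ?Q * ?W) = 0"
    by simp
  then have "(?Q * ?W) * (fps_X * fps_deriv ?W) + ?W ^ 2 * (fps_X * fps_deriv ?Q) = 0"
    by (simp add: algebra_simps power2_eq_square)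
  then have "fps_X * fps_deriv ?W = ?W ^ 2 * (fps_X * fps_deriv ?Q)"
    by (simp add: wp'_scaled_times_w_scaled)
  also have "\<dots> = 3 * ?W * (?Q * ?W) + 3 * (?P * ?W) ^ 2 + fps_const a * fps_X ^ 4 * ?W ^ 2"
    unfolding wp'_scaled_derivative by (simp add: algebra_simps power2_eq_square)
  finally show ?thesis by (simp add: wp'_scaled_times_w_scaled t_scaled_def)
qed

lemma t_scaled_derivative:
  "t_scaled a b + fps_X * fps_deriv (t_scaled a b) =
    1 - 2 * fps_const a * fps_X ^ 4 * (t_scaled a b * w_scaled a b) - 3 * fps_const b * fps_X ^ 6 * w_scaled a b ^ 2"
proof -
  let ?Q = "wp'_scaled a b" and ?P = "wp_scaled a b" and ?W = "w_scaled a b"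
  have "1 = (?Q * ?W) ^ 2"
    by (simp add: wp'_scaled_times_w_scaled)
  also have "\<dots> = ?Q ^ 2 * ?W ^ 2"
    by (simp add: power2_eq_square)
  also have "\<dots> = ?P * (?P * ?W) ^ 2 + fps_const a * fps_X ^ 4 * ((?P * ?W) * ?W) + fps_const b * fps_X ^ 6 * ?W ^ 2"
    unfolding wp_scaled_weierstrass by (simp add: algebra_simps power2_eq_square power3_eq_cube)
  finally have 1: "?P * t_scaled a b ^ 2 =
      1 - fps_const a * fps_X ^ 4 * (t_scaled a b * ?W) - fps_const b * fps_X ^ 6 * ?W ^ 2"
    by (simp add: t_scaled_def algebra_simps)
  have "t_scaled a b + fps_X * fps_deriv (t_scaled a b) =
      ?P * ?W + (fps_X * fps_deriv ?P) * ?W + ?P * (fps_X * fps_deriv ?W)"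
    by (simp add: t_scaled_def algebra_simps)
  also have "\<dots> = 2 * (?Q * ?W) + 3 * (?P * t_scaled a b ^ 2) + fps_const a * fps_X ^ 4 * ((?P * ?W) * ?W)"
    unfolding wp_scaled_derivative w_scaled_derivative by (simp add: algebra_simps power2_eq_square)
  also have "\<dots> = - 2 + 3 * (?P * t_scaled a b ^ 2) + fps_const a * fps_X ^ 4 * (t_scaled a b * ?W)"
    by (simp add: wp'_scaled_times_w_scaled t_scaled_def)
  also have "\<dots> = 1 - 2 * fps_const a * fps_X ^ 4 * (t_scaled a b * ?W) - 3 * fps_const b * fps_X ^ 6 * ?W ^ 2"
    unfolding 1 by (simp add: algebra_simps)
  finally show ?thesis .
qed

text \<open>The right-hand sides are \<open>\<partial>E/\<partial>w\<close> and \<open>- \<partial>E/\<partial>t\<close> for \<open>E = w - t\<^sup>3 - a t w\<^sup>2 - b w\<^sup>3\<close>. What matters is that no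
  denominators are left, in contrast to the recursion for the coefficients of \<open>\<wp>\<close>.\<close>

lemma hamiltonian_system:
  fixes a b :: "'a::field_char_0"
  defines "t \<equiv> fps_X * t_scaled a b" and "w \<equiv> fps_X ^ 3 * w_scaled a b"
  shows "fps_deriv t = 1 - 2 * fps_const a * (t * w) - 3 * fps_const b * w ^ 2"
    and "fps_deriv w = 3 * t ^ 2 + fps_const a * w ^ 2"
proof -
  have "fps_deriv t = t_scaled a b + fps_X * fps_deriv (t_scaled a b)"
    by (simp add: t_def)
  also have "\<dots> = 1 - 2 * fps_const a * (t * w) - 3 * fps_const b * w ^ 2"
    unfolding t_scaled_derivative t_def w_def by (simp add: algebra_simps eval_nat_numeral)
  finally show "fps_deriv t = \<dots>" .
  have d3: "fps_deriv (fps_X ^ 3 :: 'a fps) = 3 * fps_X ^ 2"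
    by (simp add: fps_deriv_power numeral_fps_const)
  have "fps_deriv w = fps_X ^ 2 * (3 * w_scaled a b + fps_X * fps_deriv (w_scaled a b))"
    unfolding w_def fps_deriv_mult d3 by (simp add: algebra_simps power2_eq_square power3_eq_cube)
  also have "\<dots> = 3 * t ^ 2 + fps_const a * w ^ 2"
    unfolding w_scaled_derivative t_def w_def by (simp add: algebra_simps eval_nat_numeral)
  finally show "fps_deriv w = \<dots>" .
qed

section \<open>The absolute value on the fraction field\<close>

lemma fract_abs_nonneg: "0 \<le> fract_abs (q :: 'a::valued_idom fract)"
  by (cases q) (simp add: fract_abs_Fract vabs_nonneg)

lemma fract_abs_mult: "fract_abs (q * r :: 'a::valued_idom fract) = fract_abs q * fract_abs r"
  by (cases q; cases r) (simp add: fract_abs_Fract vabs_mult)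

lemma fract_abs_to_fract: "fract_abs (to_fract x) = vabs x"
  by (simp add: to_fract_def fract_abs_Fract)

lemma fract_abs_0 [simp]: "fract_abs (0 :: 'a::valued_idom fract) = 0"
  using fract_abs_to_fract[of "0 :: 'a"] by simp

lemma fract_abs_1 [simp]: "fract_abs (1 :: 'a::valued_idom fract) = 1"
  using fract_abs_to_fract[of "1 :: 'a"] by simp

lemma fract_abs_eq_0_iff [simp]: "fract_abs (q :: 'a::valued_idom fract) = 0 \<longleftrightarrow> q = 0"
  using dist_eq_0_iff[of q 0] by (simp add: dist_fract_def)

lemma fract_abs_minus: "fract_abs (- q :: 'a::valued_idom fract) = fract_abs q"
  by (cases q) (simp add: fract_abs_Fract vabs_minus)

lemma fract_abs_add: "fract_abs (q + r :: 'a::valued_idom fract) \<le> max (fract_abs q) (fract_abs r)"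
proof (cases q; cases r)
  fix a b c d :: 'a
  assume q: "q = Fract a b" "b \<noteq> 0" and r: "r = Fract c d" "d \<noteq> 0"
  have pos: "vabs b > 0" "vabs d > 0"
    using q r vabs_nonneg[of b] vabs_nonneg[of d] by (simp_all add: less_le)
  have "vabs (a * d + c * b) \<le> max (vabs a * vabs d) (vabs c * vabs b)"
    using vabs_add_le_max[of "a * d" "c * b"] by (simp add: vabs_mult)
  also have "\<dots> = max (vabs a / vabs b) (vabs c / vabs d) * (vabs b * vabs d)"
    using pos q(2) r(2) by (simp add: max_mult_distrib_right)
  finally show ?thesis
    using q r pos by (simp add: fract_abs_Fract vabs_mult pos_divide_le_eq)
qed

lemma fract_abs_add_le:
  fixes q r :: "'a::valued_idom fract"
  shows "fract_abs q \<le> c \<Longrightarrow> fract_abs r \<le> c \<Longrightarrow> fract_abs (q + r) \<le> c"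
  using fract_abs_add[of q r] by linarith

lemma fract_abs_diff_le:
  fixes q r :: "'a::valued_idom fract"
  shows "fract_abs q \<le> c \<Longrightarrow> fract_abs r \<le> c \<Longrightarrow> fract_abs (q - r) \<le> c"
  using fract_abs_add_le[of q c "- r"] by (simp add: fract_abs_minus)

lemma fract_abs_sum_le:
  fixes f :: "'b \<Rightarrow> 'a::valued_idom fract"
  assumes "\<And>i. i \<in> A \<Longrightarrow> fract_abs (f i) \<le> c" and "0 \<le> c"
  shows "fract_abs (sum f A) \<le> c"
  using assms by (induction A rule: infinite_finite_induct) (auto intro: fract_abs_add_le)

lemma fract_abs_add_eq:
  fixes q r :: "'a::valued_idom fract"
  assumes "fract_abs r < fract_abs q"
  shows "fract_abs (q + r) = fract_abs q"
  using fract_abs_add[of q r] fract_abs_add[of "q + r" "- r"] assms by (simp add: fract_abs_minus)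

lemma fract_abs_power: "fract_abs (q ^ n :: 'a::valued_idom fract) = fract_abs q ^ n"
  by (induction n) (simp_all add: fract_abs_mult)

lemma fract_abs_of_nat_le_1: "fract_abs (of_nat n :: 'a::valued_idom fract) \<le> 1"
  by (induction n) (auto intro: fract_abs_add_le)

lemma fract_abs_numeral_le_1: "fract_abs (numeral n :: 'a::valued_idom fract) \<le> 1"
  using fract_abs_of_nat_le_1[of "numeral n"] by simp

lemma fract_abs_mult_le:
  fixes q r :: "'a::valued_idom fract"
  shows "fract_abs q \<le> c \<Longrightarrow> fract_abs r \<le> d \<Longrightarrow> fract_abs (q * r) \<le> c * d"
  unfolding fract_abs_mult by (meson fract_abs_nonneg mult_mono order_trans)

lemma fract_abs_mult_le_1:
  fixes q r :: "'a::valued_idom fract"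
  shows "fract_abs q \<le> 1 \<Longrightarrow> fract_abs r \<le> 1 \<Longrightarrow> fract_abs (q * r) \<le> 1"
  using fract_abs_mult_le[of q 1 r 1] by simp

section \<open>Growth of coefficients\<close>

text \<open>Series whose coefficients satisfy \<open>\<bar>f\<^sub>n\<bar> \<le> \<rho>\<^sup>n\<close> form a ring by the ultrametric inequality. The bound is stated up to a
  given degree, for use in inductions on the degree.\<close>

lemma growth_mult_nth:
  fixes f g :: "'a::valued_idom fract fps"
  assumes "\<And>i. i \<le> n \<Longrightarrow> fract_abs (fps_nth f i) \<le> \<rho> ^ i"
    and "\<And>i. i \<le> n \<Longrightarrow> fract_abs (fps_nth g i) \<le> \<rho> ^ i" and "0 \<le> \<rho>"
  shows "fract_abs (fps_nth (f * g) n) \<le> \<rho> ^ n"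
  unfolding fps_mult_nth
proof (rule fract_abs_sum_le)
  fix i assume "i \<in> {0..n}"
  then show "fract_abs (fps_nth f i * fps_nth g (n - i)) \<le> \<rho> ^ n"
    using fract_abs_mult_le[OF assms(1)[of i] assms(2)[of "n - i"]] by (simp flip: power_add)
qed (use assms(3) in simp)

text \<open>Division by a series of constant term 1 preserves the bound: the coefficients of the quotient are
  computed recursively without division.\<close>

lemma growth_divisor:
  fixes f g :: "'a::valued_idom fract fps"
  assumes fg: "\<And>n. fract_abs (fps_nth (f * g) n) \<le> \<rho> ^ n"
    and g: "\<And>n. fract_abs (fps_nth g n) \<le> \<rho> ^ n" and "fps_nth g 0 = 1" and "0 \<le> \<rho>"
  shows "fract_abs (fps_nth f n) \<le> \<rho> ^ n"
proof (induction n rule: less_induct)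
  case (less n)
  have "fps_nth (f * g) n = fps_nth f n + (\<Sum>i<n. fps_nth f i * fps_nth g (n - i))"
    using assms(3) by (simp add: fps_mult_nth atLeast0AtMost lessThan_Suc_atMost[symmetric] add.commute)
  then have "fps_nth f n = fps_nth (f * g) n - (\<Sum>i<n. fps_nth f i * fps_nth g (n - i))"
    by simp
  moreover have "fract_abs (\<Sum>i<n. fps_nth f i * fps_nth g (n - i)) \<le> \<rho> ^ n"
  proof (rule fract_abs_sum_le)
    fix i assume "i \<in> {..<n}"
    then show "fract_abs (fps_nth f i * fps_nth g (n - i)) \<le> \<rho> ^ n"
      using fract_abs_mult_le[OF less.IH[of i] g[of "n - i"]] by (simp flip: power_add)
  qed (use assms(4) in simp)
  ultimately show ?case using fg[of n] by (auto intro: fract_abs_diff_le)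
qed

text \<open>The equation expresses the coefficient of degree \<open>n\<close> of \<open>W\<close> by \<open>T\<close> and by coefficients of \<open>W\<close> of degree at most
  \<open>n - 4\<close>, so a bound on \<open>T\<close> carries over to \<open>W\<close>. This estimate is sharper than the one which the
  derivatives of \<open>w = z\<^sup>3 W\<close> give, where the shift by three degrees would be lost.\<close>

lemma growth_of_curve:
  fixes a b :: "'a::valued_idom fract"
  assumes W: "W = T ^ 3 + fps_const a * fps_X ^ 4 * (T * W ^ 2) + fps_const b * fps_X ^ 6 * W ^ 3"
    and T: "\<And>n. fract_abs (fps_nth T n) \<le> \<rho> ^ n"
    and a: "fract_abs a \<le> 1" and b: "fract_abs b \<le> 1" and \<rho>: "1 \<le> \<rho>"
  shows "fract_abs (fps_nth W n) \<le> \<rho> ^ n"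
proof (induction n rule: less_induct)
  case (less n)
  have \<rho>0: "0 \<le> \<rho>" using \<rho> by simp
  have T3: "fract_abs (fps_nth (T ^ 3) n) \<le> \<rho> ^ n"
    unfolding power3_eq_cube using T \<rho>0 by (intro growth_mult_nth)
  have shifted: "fract_abs (c * (if n < k then 0 else fps_nth f (n - k))) \<le> \<rho> ^ n"
    if "fract_abs c \<le> 1" and "n \<ge> k \<Longrightarrow> fract_abs (fps_nth f (n - k)) \<le> \<rho> ^ (n - k)" for c k f
  proof (cases "n < k")
    case False
    have "\<rho> ^ (n - k) \<le> \<rho> ^ n" using \<rho> by (intro power_increasing) auto
    then show ?thesis
      using False that fract_abs_mult_le[OF that(1), of "fps_nth f (n - k)" "\<rho> ^ n"] by auto
  qed (use \<rho>0 in simp)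
  have 4: "fract_abs (a * (if n < 4 then 0 else fps_nth (T * W ^ 2) (n - 4))) \<le> \<rho> ^ n"
  proof (rule shifted[OF a])
    assume "4 \<le> n"
    then have "fract_abs (fps_nth W i) \<le> \<rho> ^ i" if "i \<le> n - 4" for i
      using that less.IH[of i] by linarith
    then show "fract_abs (fps_nth (T * W ^ 2) (n - 4)) \<le> \<rho> ^ (n - 4)"
      unfolding power2_eq_square using T \<rho>0 by (intro growth_mult_nth) auto
  qed
  have 6: "fract_abs (b * (if n < 6 then 0 else fps_nth (W ^ 3) (n - 6))) \<le> \<rho> ^ n"
  proof (rule shifted[OF b])
    assume "6 \<le> n"
    then have "fract_abs (fps_nth W i) \<le> \<rho> ^ i" if "i \<le> n - 6" for i
      using that less.IH[of i] by linarith
    then show "fract_abs (fps_nth (W ^ 3) (n - 6)) \<le> \<rho> ^ (n - 6)"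
      unfolding power3_eq_cube using \<rho>0 by (intro growth_mult_nth) auto
  qed
  have "fps_nth W n = fps_nth (T ^ 3) n + a * (if n < 4 then 0 else fps_nth (T * W ^ 2) (n - 4))
      + b * (if n < 6 then 0 else fps_nth (W ^ 3) (n - 6))"
    by (subst W) (simp add: mult.assoc fps_X_power_mult_nth)
  then show ?case
    using T3 4 6 by (auto intro!: fract_abs_add_le)
qed

text \<open>Series all of whose derivatives at \<open>0\<close> are integral form a ring, by Leibniz' rule and the integrality of
  binomial coefficients.\<close>

lemma hurwitz_mult_nth:
  fixes f g :: "'a::valued_idom fract fps"
  assumes "\<And>i. i \<le> n \<Longrightarrow> fract_abs (of_nat (fact i) * fps_nth f i) \<le> 1"
    and "\<And>i. i \<le> n \<Longrightarrow> fract_abs (of_nat (fact i) * fps_nth g i) \<le> 1"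
  shows "fract_abs (of_nat (fact n) * fps_nth (f * g) n) \<le> 1"
  unfolding fps_mult_nth sum_distrib_left
proof (rule fract_abs_sum_le)
  fix i assume i: "i \<in> {0..n}"
  have "(of_nat (fact n) :: 'a fract) = of_nat (fact i * fact (n - i) * (n choose i))"
    using i by (subst binomial_fact_lemma) auto
  then have "of_nat (fact n) * (fps_nth f i * fps_nth g (n - i)) =
      of_nat (n choose i) * ((of_nat (fact i) * fps_nth f i) * (of_nat (fact (n - i)) * fps_nth g (n - i)))"
    by (simp add: mult_ac)
  then show "fract_abs (of_nat (fact n) * (fps_nth f i * fps_nth g (n - i))) \<le> 1"
    using i by (simp only:) (intro fract_abs_mult_le_1[OF fract_abs_of_nat_le_1 fract_abs_mult_le_1[OF assms]]; simp)
qed simp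

text \<open>Differentiating the system \<open>n\<close> times expresses the derivatives of order \<open>n + 1\<close> at \<open>0\<close> by those of lower
  order with integral coefficients.\<close>

lemma hurwitz_of_hamiltonian_system:
  fixes a b :: "'a::valued_idom fract"
  assumes t: "fps_deriv t = 1 - 2 * fps_const a * (t * w) - 3 * fps_const b * w ^ 2"
    and w: "fps_deriv w = 3 * t ^ 2 + fps_const a * w ^ 2"
    and 0: "fps_nth t 0 = 0" "fps_nth w 0 = 0"
    and ab: "fract_abs a \<le> 1" "fract_abs b \<le> 1"
  shows "fract_abs (of_nat (fact n) * fps_nth t n) \<le> 1 \<and> fract_abs (of_nat (fact n) * fps_nth w n) \<le> 1"
proof (induction n rule: less_induct)
  case (less n)
  show ?case
  proof (cases n)
    case 0
    then show ?thesis using 0 assms(3,4) by simp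
  next
    case (Suc m)
    have IH: "fract_abs (of_nat (fact i) * fps_nth t i) \<le> 1" "fract_abs (of_nat (fact i) * fps_nth w i) \<le> 1" if "i \<le> m" for i
      using less.IH[of i] that Suc by auto
    have prods: "fract_abs (of_nat (fact m) * fps_nth (t * w) m) \<le> 1" "fract_abs (of_nat (fact m) * fps_nth (w * w) m) \<le> 1"
        "fract_abs (of_nat (fact m) * fps_nth (t * t) m) \<le> 1"
      using IH by (auto intro!: hurwitz_mult_nth)
    have num: "fps_nth (numeral k * f) m = numeral k * fps_nth f m" for k and f :: "'a fract fps"
      by (simp add: numeral_fps_const)
    have deriv: "of_nat (fact n) * fps_nth f n = of_nat (fact m) * fps_nth (fps_deriv f) m" for f :: "'a fract fps"
      by (simp add: Suc algebra_simps)
    have one: "fract_abs (of_nat (fact m) * fps_nth 1 m :: 'a fract) \<le> 1"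
      by (cases m) simp_all
    have nth_t: "fps_nth (1 - 2 * fps_const a * (t * w) - 3 * fps_const b * w ^ 2) m =
        fps_nth 1 m - 2 * a * fps_nth (t * w) m - 3 * b * fps_nth (w * w) m"
      by (simp add: num mult.assoc power2_eq_square)
    have nth_w: "fps_nth (3 * t ^ 2 + fps_const a * w ^ 2) m = 3 * fps_nth (t * t) m + a * fps_nth (w * w) m"
      by (simp add: num power2_eq_square)
    have "of_nat (fact n) * fps_nth t n = of_nat (fact m) * fps_nth 1 m - 2 * a * (of_nat (fact m) * fps_nth (t * w) m)
        - 3 * b * (of_nat (fact m) * fps_nth (w * w) m)"
      unfolding deriv t nth_t by (simp only: algebra_simps)
    moreover have "of_nat (fact n) * fps_nth w n = 3 * (of_nat (fact m) * fps_nth (t * t) m) + a * (of_nat (fact m) * fps_nth (w * w) m)"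
      unfolding deriv w nth_w by (simp only: algebra_simps)
    ultimately show ?thesis
      using one prods ab
      by (auto intro!: fract_abs_add_le fract_abs_diff_le fract_abs_mult_le_1 fract_abs_numeral_le_1 simp del: fps_one_nth)
  qed
qed

section \<open>Evaluation of power series in a valued field\<close>

text \<open>The value of a power series at \<open>z\<close>, together with a rate of convergence: the tails decay at least like
  \<open>\<theta>\<^sup>N\<close>. In the ultrametric setting this form is stable under products with the same rate.\<close>

definition evaluates_to :: "real \<Rightarrow> 'a::valued_idom fract fps \<Rightarrow> 'a fract \<Rightarrow> 'a fract \<Rightarrow> bool"
  where "evaluates_to \<theta> f z s \<longleftrightarrow> (\<forall>N. fract_abs (s - (\<Sum>n<N. fps_nth f n * z ^ n)) \<le> \<theta> ^ N)"

lemma evaluates_toD: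
  "evaluates_to \<theta> f z s \<Longrightarrow> fract_abs (s - (\<Sum>n<N. fps_nth f n * z ^ n)) \<le> \<theta> ^ N"
  by (simp add: evaluates_to_def)

lemma evaluates_to_le_1: "evaluates_to \<theta> f z s \<Longrightarrow> fract_abs s \<le> 1"
  using evaluates_toD[of \<theta> f z s 0] by simp

text \<open>A term is the difference of two consecutive tails.\<close>

lemma evaluates_to_term_le:
  assumes "evaluates_to \<theta> f z s" and "0 \<le> \<theta>" and "\<theta> \<le> 1"
  shows "fract_abs (fps_nth f n * z ^ n) \<le> \<theta> ^ n"
proof -
  let ?S = "\<lambda>N. \<Sum>n<N. fps_nth f n * z ^ n"
  have "fract_abs (s - ?S (Suc n)) \<le> \<theta> ^ n"
    using evaluates_toD[OF assms(1), of "Suc n"] power_decreasing[of n "Suc n" \<theta>] assms(2,3) by linarith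
  then have "fract_abs ((s - ?S n) - (s - ?S (Suc n))) \<le> \<theta> ^ n"
    by (rule fract_abs_diff_le[OF evaluates_toD[OF assms(1)]])
  then show ?thesis by simp
qed

lemma evaluates_to_unique:
  assumes "evaluates_to \<theta> f z s" and "evaluates_to \<theta> f z s'" and "0 \<le> \<theta>" and "\<theta> < 1"
  shows "s = s'"
proof -
  have le: "fract_abs (s - s') \<le> \<theta> ^ N" for N
    using fract_abs_diff_le[OF evaluates_toD[OF assms(1), of N] evaluates_toD[OF assms(2), of N]] by simp
  have "(\<lambda>N. \<theta> ^ N) \<longlonglongrightarrow> 0"
    using assms(3,4) by (intro LIMSEQ_power_zero) simp
  then have "fract_abs (s - s') \<le> 0"
    by (rule LIMSEQ_le_const) (use le in blast)
  then show ?thesis using fract_abs_nonneg[of "s - s'"] by simp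
qed

lemma evaluates_to_add:
  assumes "evaluates_to \<theta> f z s" and "evaluates_to \<theta> g z r"
  shows "evaluates_to \<theta> (f + g) z (s + r)"
  unfolding evaluates_to_def
proof
  fix N
  have "s + r - (\<Sum>n<N. fps_nth (f + g) n * z ^ n) =
      (s - (\<Sum>n<N. fps_nth f n * z ^ n)) + (r - (\<Sum>n<N. fps_nth g n * z ^ n))"
    by (simp add: algebra_simps sum.distrib)
  then show "fract_abs (s + r - (\<Sum>n<N. fps_nth (f + g) n * z ^ n)) \<le> \<theta> ^ N"
    by (simp only: fract_abs_add_le[OF evaluates_toD[OF assms(1)] evaluates_toD[OF assms(2)]])
qed

lemma evaluates_to_const:
  assumes "fract_abs c \<le> 1" and "0 \<le> \<theta>"
  shows "evaluates_to \<theta> (fps_const c) z c"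
  unfolding evaluates_to_def
proof
  fix N
  show "fract_abs (c - (\<Sum>n<N. fps_nth (fps_const c) n * z ^ n)) \<le> \<theta> ^ N"
  proof (cases N)
    case (Suc m)
    have "(\<Sum>n<Suc m. fps_nth (fps_const c) n * z ^ n) = c"
      by (subst sum.lessThan_Suc_shift) simp
    then show ?thesis using Suc assms by simp
  qed (use assms in simp)
qed

lemma evaluates_to_fps_X:
  assumes "fract_abs z \<le> \<theta>" and "\<theta> \<le> 1"
  shows "evaluates_to \<theta> fps_X z z"
  unfolding evaluates_to_def
proof
  fix N
  have \<theta>: "0 \<le> \<theta>" using assms(1) fract_abs_nonneg[of z] by linarith
  consider "N = 0" | "N = 1" | m where "N = Suc (Suc m)"
    by (metis One_nat_def not0_implies_Suc)
  then show "fract_abs (z - (\<Sum>n<N. fps_nth fps_X n * z ^ n)) \<le> \<theta> ^ N"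
  proof cases
    case 3
    have "(\<Sum>n<Suc (Suc m). fps_nth fps_X n * z ^ n) = z"
      by (simp only: sum.lessThan_Suc_shift) simp
    then show ?thesis using 3 \<theta> by simp
  qed (use assms in auto)
qed

text \<open>Both sides sum \<open>u\<^sub>i v\<^sub>j\<close> over the triangle \<open>i + j < N\<close>.\<close>

lemma cauchy_product_partial_sum:
  fixes u v :: "nat \<Rightarrow> 'a::comm_ring_1"
  shows "(\<Sum>n<N. \<Sum>i = 0..n. u i * v (n - i)) = (\<Sum>i<N. u i * (\<Sum>j<N - i. v j))"
proof (induction N)
  case (Suc N)
  have "(\<Sum>i<Suc N. u i * (\<Sum>j<Suc N - i. v j)) = (\<Sum>i<Suc N. u i * (\<Sum>j<N - i. v j) + u i * v (N - i))"
    by (intro sum.cong) (auto simp: Suc_diff_le distrib_left)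
  also have "\<dots> = (\<Sum>i<N. u i * (\<Sum>j<N - i. v j)) + (\<Sum>i = 0..N. u i * v (N - i))"
    by (simp add: sum.distrib atLeast0AtMost lessThan_Suc_atMost[symmetric] algebra_simps)
  finally show ?case using Suc by simp
qed simp

text \<open>The partial sum of the Cauchy product runs over a triangle. Its difference to \<open>s r\<close> is the tail
  of the first factor times \<open>r\<close>, plus for each \<open>i\<close> the term of degree \<open>i\<close> times a tail of the second factor from
  degree \<open>N - i\<close> on, and each of these is at most \<open>\<theta>\<^sup>N\<close>.\<close>

lemma evaluates_to_mult:
  assumes f: "evaluates_to \<theta> f z s" and g: "evaluates_to \<theta> g z r" and \<theta>: "0 \<le> \<theta>" "\<theta> \<le> 1"
  shows "evaluates_to \<theta> (f * g) z (s * r)"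
  unfolding evaluates_to_def
proof
  fix N
  define u where "u i = fps_nth f i * z ^ i" for i
  define v where "v j = fps_nth g j * z ^ j" for j
  have "(\<Sum>n<N. fps_nth (f * g) n * z ^ n) = (\<Sum>n<N. \<Sum>i = 0..n. u i * v (n - i))"
  proof (intro sum.cong refl)
    fix n
    have "z ^ n = z ^ i * z ^ (n - i)" if "i \<in> {0..n}" for i
      using that by (simp flip: power_add)
    then show "fps_nth (f * g) n * z ^ n = (\<Sum>i = 0..n. u i * v (n - i))"
      unfolding fps_mult_nth sum_distrib_right u_def v_def by (intro sum.cong refl) (simp add: mult_ac)
  qed
  also have "\<dots> = (\<Sum>i<N. u i * (\<Sum>j<N - i. v j))"
    by (rule cauchy_product_partial_sum)
  finally have "s * r - (\<Sum>n<N. fps_nth (f * g) n * z ^ n) =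
      (s - (\<Sum>i<N. u i)) * r + (\<Sum>i<N. u i * (r - (\<Sum>j<N - i. v j)))"
    by (simp add: algebra_simps sum_subtractf sum_distrib_left)
  moreover have "fract_abs ((s - (\<Sum>i<N. u i)) * r) \<le> \<theta> ^ N"
    using fract_abs_mult_le[of "s - (\<Sum>i<N. u i)" "\<theta> ^ N" r 1] f evaluates_to_le_1[OF g]
    by (simp add: evaluates_to_def u_def)
  moreover have "fract_abs (\<Sum>i<N. u i * (r - (\<Sum>j<N - i. v j))) \<le> \<theta> ^ N"
  proof (rule fract_abs_sum_le)
    fix i assume "i \<in> {..<N}"
    moreover have "fract_abs (r - (\<Sum>j<N - i. v j)) \<le> \<theta> ^ (N - i)"
      using g by (simp add: evaluates_to_def v_def)
    ultimately show "fract_abs (u i * (r - (\<Sum>j<N - i. v j))) \<le> \<theta> ^ N"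
      using fract_abs_mult_le[OF evaluates_to_term_le[OF f \<theta>, of i], of "r - (\<Sum>j<N - i. v j)" "\<theta> ^ (N - i)"]
      by (simp add: u_def flip: power_add)
  qed (use \<theta> in simp)
  ultimately show "fract_abs (s * r - (\<Sum>n<N. fps_nth (f * g) n * z ^ n)) \<le> \<theta> ^ N"
    by (simp add: fract_abs_add_le)
qed

lemma evaluates_to_power:
  assumes "evaluates_to \<theta> f z s" and "0 \<le> \<theta>" "\<theta> \<le> 1"
  shows "evaluates_to \<theta> (f ^ n) z (s ^ n)"
proof (induction n)
  case 0
  then show ?case using evaluates_to_const[of 1 \<theta> z] assms by simp
qed (use assms in \<open>auto intro: evaluates_to_mult\<close>)

text \<open>For \<open>t(z) = z f(z)\<close> the quotient \<open>(t(z) - t(z')) / (z - z')\<close> is the sum of the \<open>f\<^sub>n h\<^sub>n(z, z')\<close>, where \<open>h\<^sub>n\<close> is the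
  complete homogeneous polynomial of degree \<open>n\<close>. Its term for \<open>n = 0\<close> is 1 and the others have absolute value less
  than 1, so it is a unit. The argument is carried out for partial sums that are closer to the limit
  than \<open>z\<close> is to \<open>z'\<close>.\<close>

lemma evaluates_to_isometry:
  fixes z z' :: "'a::valued_idom fract"
  assumes f: "evaluates_to \<theta> f z s" and f': "evaluates_to \<theta> f z' s'" and f0: "fps_nth f 0 = 1"
    and growth: "\<And>n. fract_abs (fps_nth f n) * r ^ n \<le> \<theta> ^ n"
    and z: "fract_abs z \<le> r" "fract_abs z' \<le> r" and "r \<le> 1" and \<theta>: "0 \<le> \<theta>" "\<theta> < 1"
  shows "fract_abs (z * s - z' * s') = fract_abs (z - z')"
proof (cases "z = z'")
  case True
  then show ?thesis using evaluates_to_unique[OF f, of s'] f' \<theta> by simp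
next
  case False
  have r0: "0 \<le> r" using z(1) fract_abs_nonneg[of z] by linarith
  have "0 < fract_abs (z - z')"
    using False fract_abs_nonneg[of "z - z'"] by (simp add: less_le)
  then obtain N where N: "\<theta> ^ N < fract_abs (z - z')"
    using \<theta> real_arch_pow_inv by blast
  \<comment> \<open>At least one term is needed, so that the partial sum starts with 1.\<close>
  define M where "M = Suc N"
  have M: "\<theta> ^ M < fract_abs (z - z')"
    using N \<theta> power_decreasing[of N "Suc N" \<theta>] by (simp add: M_def)
  let ?S = "\<lambda>x. \<Sum>n<M. fps_nth f n * x ^ n"
  define h where "h n = (\<Sum>i<Suc n. z' ^ (Suc n - Suc i) * z ^ i)" for n
  have h: "fract_abs (h n) \<le> r ^ n" for n
    unfolding h_def
  proof (rule fract_abs_sum_le)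
    fix i assume "i \<in> {..<Suc n}"
    moreover have "fract_abs (z' ^ (Suc n - Suc i) * z ^ i) \<le> r ^ (Suc n - Suc i) * r ^ i"
      using z by (intro fract_abs_mult_le) (auto simp: fract_abs_power intro!: power_mono fract_abs_nonneg)
    ultimately show "fract_abs (z' ^ (Suc n - Suc i) * z ^ i) \<le> r ^ n"
      by (simp flip: power_add)
  qed (use r0 in simp)
  have "z * ?S z - z' * ?S z' = (\<Sum>n<M. fps_nth f n * (z ^ Suc n - z' ^ Suc n))"
    by (simp add: sum_distrib_left sum_subtractf algebra_simps)
  also have "\<dots> = (z - z') * (\<Sum>n<M. fps_nth f n * h n)"
    unfolding h_def power_diff_sumr2 by (simp add: sum_distrib_left mult_ac)
  also have "(\<Sum>n<M. fps_nth f n * h n) = 1 + (\<Sum>n<N. fps_nth f (Suc n) * h (Suc n))"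
    unfolding M_def by (subst sum.lessThan_Suc_shift) (simp add: f0 h_def)
  finally have S: "z * ?S z - z' * ?S z' = (z - z') * (1 + (\<Sum>n<N. fps_nth f (Suc n) * h (Suc n)))" .
  have "fract_abs (\<Sum>n<N. fps_nth f (Suc n) * h (Suc n)) \<le> \<theta>"
  proof (rule fract_abs_sum_le)
    fix n
    have "fract_abs (fps_nth f (Suc n) * h (Suc n)) \<le> fract_abs (fps_nth f (Suc n)) * r ^ Suc n"
      by (rule fract_abs_mult_le) (simp_all only: h order_refl)
    also have "\<dots> \<le> \<theta> ^ Suc n" by (rule growth)
    also have "\<dots> \<le> \<theta>" using \<theta> power_decreasing[of 1 "Suc n" \<theta>] by simp
    finally show "fract_abs (fps_nth f (Suc n) * h (Suc n)) \<le> \<theta>" .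
  qed (use \<theta> in simp)
  then have "fract_abs (1 + (\<Sum>n<N. fps_nth f (Suc n) * h (Suc n))) = 1"
    using \<theta> fract_abs_add_eq[of "\<Sum>n<N. fps_nth f (Suc n) * h (Suc n)" 1] by simp
  then have main: "fract_abs (z * ?S z - z' * ?S z') = fract_abs (z - z')"
    unfolding S fract_abs_mult by simp
  have "fract_abs (x * (y - ?S x)) \<le> \<theta> ^ M" if "evaluates_to \<theta> f x y" "fract_abs x \<le> r" for x y
    using fract_abs_mult_le[of x 1 "y - ?S x" "\<theta> ^ M"] that \<open>r \<le> 1\<close> by (simp add: evaluates_to_def)
  then have "fract_abs (z * (s - ?S z) - z' * (s' - ?S z')) \<le> \<theta> ^ M"
    using f f' z by (auto intro!: fract_abs_diff_le)
  then have "fract_abs ((z * ?S z - z' * ?S z') + (z * (s - ?S z) - z' * (s' - ?S z'))) = fract_abs (z - z')"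
    using main M by (subst fract_abs_add_eq) auto
  then show ?thesis by (simp add: algebra_simps)
qed

section \<open>p-adic integers\<close>

lemma padic_residue_one: "padic_residue (1 :: 'p::prime_card padic_int) n = 1 mod int CARD('p) ^ n"
  by (simp add: one_padic_int.rep_eq)

lemma padic_residue_of_nat: "padic_residue (of_nat m :: 'p::prime_card padic_int) n = int m mod int CARD('p) ^ n"
  by (induction m) (simp_all add: padic_residue_add padic_residue_one mod_simps)

lemma padic_residue_diff:
  "padic_residue (x - y :: 'p::prime_card padic_int) n = (padic_residue x n - padic_residue y n) mod int CARD('p) ^ n"
  by (simp add: minus_padic_int.rep_eq)

lemma real_card_gt_1: "1 < real CARD('p::prime_card)"
  using card_gt_1[where 'p='p] by simp

instance padic_int :: (prime_card) ring_char_0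
proof
  show "inj (of_nat :: nat \<Rightarrow> 'a padic_int)"
  proof (rule injI)
    fix m n :: nat
    assume eq: "(of_nat m :: 'a padic_int) = of_nat n"
    have lt: "int i < int CARD('a) ^ (m + n)" if "i \<le> m + n" for i
    proof -
      have "1 < CARD('a)" using card_gt_1[where 'p='a] by simp
      then have "m + n < CARD('a) ^ (m + n)" by (simp add: power_gt_expt)
      then show ?thesis using that by (metis le_less_trans of_nat_less_iff of_nat_power)
    qed
    have "int m mod int CARD('a) ^ (m + n) = int n mod int CARD('a) ^ (m + n)"
      using eq by (metis padic_residue_of_nat)
    then show "m = n" using lt[of m] lt[of n] by simp
  qed
qed

instance fract :: ("{idom,ring_char_0}") field_char_0
proof
  show "inj (of_nat :: nat \<Rightarrow> 'a fract)"
    by (auto intro!: injI simp: of_nat_fract eq_fract)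
qed

lemma vabs_ge_of_residue:
  assumes "padic_residue (x :: 'p::prime_card padic_int) (Suc n) \<noteq> 0"
  shows "1 / real CARD('p) ^ n \<le> vabs x"
proof -
  have "(LEAST n. padic_residue x (Suc n) \<noteq> 0) \<le> n"
    using assms by (rule Least_le)
  moreover have "x \<noteq> 0" using assms by auto
  ultimately show ?thesis
    using real_card_gt_1[where 'p='p] by (auto simp: vabs_padic_int_def intro!: divide_left_mono power_increasing)
qed

lemma vabs_le_iff_residue:
  "vabs (x :: 'p::prime_card padic_int) \<le> 1 / real CARD('p) ^ n \<longleftrightarrow> padic_residue x n = 0"
proof
  assume le: "vabs x \<le> 1 / real CARD('p) ^ n"
  show "padic_residue x n = 0"
  proof (rule ccontr)
    assume ne: "padic_residue x n \<noteq> 0"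
    then obtain m where m: "n = Suc m"
      using padic_residue_bounds[of x 0] by (cases n) auto
    have "1 / real CARD('p) ^ m \<le> 1 / real CARD('p) ^ Suc m"
      using vabs_ge_of_residue[of x m] ne le m by simp
    then show False
      using real_card_gt_1[where 'p='p] by (simp add: field_simps)
  qed
next
  assume 0: "padic_residue x n = 0"
  show "vabs x \<le> 1 / real CARD('p) ^ n"
  proof (cases "x = 0")
    case False
    define l where "l = (LEAST n. padic_residue x (Suc n) \<noteq> 0)"
    have "padic_residue x (Suc l) \<noteq> 0"
      unfolding l_def using padic_int_neq_0_residue[OF False] by (metis (mono_tags, lifting) LeastI)
    then have "n \<le> l"
      using 0 padic_residue_eq_0_mono[of "Suc l" n x] by (auto simp: not_less_eq_eq[symmetric])
    then show ?thesis
      using False real_card_gt_1[where 'p='p]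
      by (auto simp: vabs_padic_int_def l_def[symmetric] intro!: divide_left_mono power_increasing)
  qed (simp add: vabs_padic_int_def)
qed

lemma vabs_padic_int_le_1: "vabs (x :: 'p::prime_card padic_int) \<le> 1"
  using vabs_le_iff_residue[of x 0] padic_residue_bounds[of x 0] by simp

text \<open>Conversely to the obvious direction, if the residue modulo \<open>p\<^sup>n\<close> vanishes, the residues modulo \<open>p\<^bsup>m + n\<^esup>\<close> are
  divisible by \<open>p\<^sup>n\<close>, and the quotients are the residues of \<open>x / p\<^sup>n\<close>.\<close>

lemma power_dvd_iff_residue: "of_nat CARD('p) ^ n dvd (x :: 'p::prime_card padic_int) \<longleftrightarrow> padic_residue x n = 0"
proof
  assume "of_nat CARD('p) ^ n dvd x"
  then obtain y where y: "x = of_nat (CARD('p) ^ n) * y" by (auto elim!: dvdE)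
  then show "padic_residue x n = 0"
    by (simp only: y padic_residue_mult padic_residue_of_nat) simp
next
  assume 0: "padic_residue x n = 0"
  define r where "r m = padic_residue x (m + n) div int CARD('p) ^ n" for m
  have dvd: "int CARD('p) ^ n dvd padic_residue x (m + n)" for m
    using 0 padic_residue_eq_0_iff_dvd[of n "m + n" x] by simp
  have r: "r m * int CARD('p) ^ n = padic_residue x (m + n)" for m
    using dvd[of m] by (simp add: r_def)
  have pos: "int CARD('p) ^ n > 0" for n by (rule card_pow_pos)
  have bound: "0 \<le> r m \<and> r m < int CARD('p) ^ m" for m
  proof -
    have "0 \<le> r m * int CARD('p) ^ n" "r m * int CARD('p) ^ n < int CARD('p) ^ m * int CARD('p) ^ n"
      using padic_residue_bounds[of x "m + n"] by (simp_all add: r power_add)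
    then show ?thesis using pos[of n] by (simp add: zero_le_mult_iff)
  qed
  have "r (Suc m) mod int CARD('p) ^ m = r m" for m
  proof -
    have "(r (Suc m) mod int CARD('p) ^ m) * int CARD('p) ^ n =
        padic_residue x (Suc (m + n)) mod int CARD('p) ^ (m + n)"
      using r[of "Suc m"] by (simp add: mult_mod_left power_add)
    also have "\<dots> = r m * int CARD('p) ^ n"
      by (simp add: padic_residue_mod_Suc r)
    finally show ?thesis using pos[of n] by simp
  qed
  then have res: "padic_residue (Abs_padic_int r :: 'p padic_int) m = r m" for m
    using bound by (subst Abs_padic_int_inverse) auto
  have "x = of_nat (CARD('p) ^ n) * (Abs_padic_int r :: 'p padic_int)"
  proof (rule padic_int_eqI)
    fix m
    have "padic_residue (of_nat (CARD('p) ^ n) * Abs_padic_int r :: 'p padic_int) m =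
        (int CARD('p) ^ n * r m) mod int CARD('p) ^ m"
      unfolding padic_residue_mult padic_residue_of_nat res by (simp add: mod_simps)
    also have "\<dots> = padic_residue x (m + n) mod int CARD('p) ^ m"
      using r[of m] by (simp add: mult.commute)
    also have "\<dots> = padic_residue x m"
      by (rule padic_residue_mod) simp
    finally show "padic_residue x m = padic_residue (of_nat (CARD('p) ^ n) * Abs_padic_int r :: 'p padic_int) m" ..
  qed
  then show "of_nat CARD('p) ^ n dvd x"
    by (metis dvd_triv_left of_nat_power)
qed

text \<open>The residues of \<open>x\<close> are invertible modulo all powers of \<open>p\<close>; their inverses are unique, hence coherent.\<close>

lemma padic_unit_of_residue:
  assumes "padic_residue (x :: 'p::prime_card padic_int) 1 \<noteq> 0"
  shows "x dvd 1"
proof -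
  have "Factorial_Ring.prime (int CARD('p))"
    using prime_card[where 'a='p] by simp
  have coprime: "coprime (padic_residue x n) (int CARD('p) ^ n)" for n
  proof (cases n)
    case (Suc m)
    have "\<not> int CARD('p) dvd padic_residue x n"
      using assms padic_residue_eq_0_iff_dvd[of 1 n x] Suc by simp
    then show ?thesis
      using prime_imp_coprime[OF \<open>Factorial_Ring.prime (int CARD('p))\<close>] by (simp add: coprime_commute)
  qed simp
  define inverse_mod where "inverse_mod n y \<longleftrightarrow> y \<in> {0..<int CARD('p) ^ n} \<and> [padic_residue x n * y = 1] (mod int CARD('p) ^ n)" for n y
  define r where "r n = (SOME y. inverse_mod n y)" for n
  have "\<exists>y. inverse_mod n y" for n
  proof -
    obtain y where "[padic_residue x n * y = 1] (mod int CARD('p) ^ n)"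
      using cong_solve_coprime_int[OF coprime] by blast
    then have "inverse_mod n (y mod int CARD('p) ^ n)"
      using card_pow_pos[where 'p='p, of n] by (simp add: inverse_mod_def cong_def mod_simps)
    then show ?thesis ..
  qed
  then have r: "inverse_mod n (r n)" for n
    unfolding r_def by (rule someI_ex)
  have "r (Suc n) mod int CARD('p) ^ n = r n" for n
  proof -
    have "[padic_residue x (Suc n) * r (Suc n) = 1] (mod int CARD('p) ^ n)"
      using r[of "Suc n"] cong_modulus_mult[of _ _ "int CARD('p) ^ n" "int CARD('p)"]
      by (simp add: inverse_mod_def mult.commute)
    moreover have "[padic_residue x (Suc n) = padic_residue x n] (mod int CARD('p) ^ n)"
      using padic_residue_mod_Suc[of x n] by (simp add: cong_def)
    ultimately have "[padic_residue x n * r (Suc n) = padic_residue x n * r n] (mod int CARD('p) ^ n)"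
      using r[of n] unfolding inverse_mod_def by (metis cong_scalar_right cong_sym cong_trans)
    then have "[r (Suc n) = r n] (mod int CARD('p) ^ n)"
      using coprime[of n] by (simp add: cong_mult_lcancel)
    then show ?thesis
      using r[of n] by (simp add: cong_def inverse_mod_def)
  qed
  then have res: "padic_residue (Abs_padic_int r :: 'p padic_int) n = r n" for n
    using r by (subst Abs_padic_int_inverse) (auto simp: inverse_mod_def)
  have "x * Abs_padic_int r = 1"
    using r by (intro padic_int_eqI) (simp add: padic_residue_mult padic_residue_one res inverse_mod_def cong_def)
  then show ?thesis by (metis dvd_triv_left)
qed

text \<open>The denominator is a power of \<open>p\<close> times a unit, and that power divides the numerator.\<close>

lemma padic_int_of_fract_abs_le_1:
  assumes "fract_abs (q :: 'p::prime_card padic) \<le> 1"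
  obtains x where "q = to_fract x"
proof -
  obtain a b where q: "q = Fract a b" and b: "b \<noteq> 0"
    by (cases q) auto
  obtain n where n: "padic_residue b n = 0" "padic_residue b (Suc n) \<noteq> 0"
    using padic_int_neq_0_residue[OF b] .
  have "0 < vabs b" using b vabs_nonneg[of b] by (simp add: less_le)
  then have "vabs a \<le> vabs b"
    using assms b by (simp add: q fract_abs_Fract)
  also have "\<dots> \<le> 1 / real CARD('p) ^ n" using n(1) by (simp add: vabs_le_iff_residue)
  finally have "of_nat CARD('p) ^ n dvd a"
    by (simp add: power_dvd_iff_residue vabs_le_iff_residue)
  then obtain c where c: "a = of_nat CARD('p) ^ n * c" ..
  have "of_nat CARD('p) ^ n dvd b"
    using n(1) by (simp add: power_dvd_iff_residue)
  then obtain u where u: "b = of_nat CARD('p) ^ n * u" ..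
  have "padic_residue u 1 \<noteq> 0"
  proof
    assume "padic_residue u 1 = 0"
    then have "of_nat CARD('p) ^ 1 dvd u" by (simp only: power_dvd_iff_residue)
    then have "of_nat CARD('p) ^ Suc n dvd b"
      unfolding u by (simp add: mult.commute mult_dvd_mono)
    then show False using n(2) by (simp add: power_dvd_iff_residue del: power_Suc)
  qed
  then obtain v where v: "1 = u * v" using padic_unit_of_residue by blast
  have "a = (c * v) * b" by (simp add: c u) (metis mult.assoc mult.commute mult_1 v)
  then have "q = to_fract (c * v)"
    using b by (simp add: q to_fract_def eq_fract)
  then show ?thesis by (rule that)
qed

text \<open>The rate at which the series converge on \<open>p\<int>\<^sub>p\<close>: their coefficients of degree \<open>n\<close> are bounded by \<open>\<surd>p\<^sup>n\<close>, and
  \<open>\<surd>p / p = 1 / \<surd>p\<close>.\<close>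

definition padic_rate :: "'p::prime_card itself \<Rightarrow> real"
  where "padic_rate _ = 1 / sqrt (real CARD('p))"

lemma padic_rate:
  "0 < padic_rate TYPE('p::prime_card)" "padic_rate TYPE('p) < 1"
  "padic_rate TYPE('p) ^ 2 = 1 / real CARD('p)"
  "padic_rate TYPE('p) ^ (2 * n) = 1 / real CARD('p) ^ n"
  using real_card_gt_1[where 'p='p] by (simp_all add: padic_rate_def power_divide power_mult)

text \<open>Completeness of the \<open>p\<close>-adic integers for this rate: the first \<open>2 m\<close> terms determine the sum modulo \<open>p\<^sup>m\<close>,
  because \<open>\<theta>\<^bsup>2 m\<^esup> = p\<^bsup>- m\<^esup>\<close>. The residues of the sum are read off from these partial sums.\<close>

lemma padic_series_converges:
  fixes f :: "nat \<Rightarrow> 'p::prime_card padic"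
  assumes "\<And>n. fract_abs (f n) \<le> padic_rate TYPE('p) ^ n"
  obtains s where "\<And>N. fract_abs (s - (\<Sum>n<N. f n)) \<le> padic_rate TYPE('p) ^ N"
proof -
  let ?\<theta> = "padic_rate TYPE('p)"
  note \<theta> = padic_rate[where 'p='p]
  have "\<exists>x. f n = to_fract x" for n
  proof -
    have "fract_abs (f n) \<le> 1"
      using assms[of n] power_le_one[of ?\<theta> n] \<theta>(1,2) by linarith
    then show ?thesis by (metis padic_int_of_fract_abs_le_1)
  qed
  then obtain g where g: "\<And>n. f n = to_fract (g n)" by metis
  have g0: "padic_residue (g n) m = 0" if "2 * m \<le> n" for m n
  proof -
    have "vabs (g n) \<le> ?\<theta> ^ n"
      using assms[of n] by (simp add: g fract_abs_to_fract)
    also have "\<dots> \<le> ?\<theta> ^ (2 * m)"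
      using that \<theta>(1,2) by (intro power_decreasing) auto
    finally show ?thesis by (simp add: \<theta>(4) vabs_le_iff_residue)
  qed
  define r where "r m = padic_residue (\<Sum>n<2 * m. g n) m" for m
  have "r (Suc m) mod int CARD('p) ^ m = r m" for m
  proof -
    have "r (Suc m) mod int CARD('p) ^ m = padic_residue (\<Sum>n<2 * Suc m. g n) m"
      unfolding r_def by (rule padic_residue_mod) simp
    also have "(\<Sum>n<2 * Suc m. g n) = (\<Sum>n<2 * m. g n) + g (2 * m) + g (2 * m + 1)"
      by simp
    also have "padic_residue \<dots> m = r m"
      by (simp add: padic_residue_add g0 r_def)
    finally show ?thesis .
  qed
  then have res: "padic_residue (Abs_padic_int r :: 'p padic_int) m = r m" for m
    using padic_residue_bounds by (subst Abs_padic_int_inverse) (auto simp: r_def)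
  define s where "s = to_fract (Abs_padic_int r :: 'p padic_int)"
  have "fract_abs (s - (\<Sum>n<N. f n)) \<le> ?\<theta> ^ N" for N
  proof -
    have "padic_residue (Abs_padic_int r - (\<Sum>n<2 * N. g n)) N = 0"
      by (simp add: padic_residue_diff res r_def)
    then have "vabs (Abs_padic_int r - (\<Sum>n<2 * N. g n)) \<le> ?\<theta> ^ (2 * N)"
      by (simp add: \<theta>(4) vabs_le_iff_residue)
    also have "\<dots> \<le> ?\<theta> ^ N"
      using \<theta>(1,2) by (intro power_decreasing) auto
    finally have tail: "fract_abs (s - (\<Sum>n<2 * N. f n)) \<le> ?\<theta> ^ N"
      by (simp add: s_def g flip: fract_abs_to_fract)
    have "fract_abs (\<Sum>n\<in>{N..<2 * N}. f n) \<le> ?\<theta> ^ N"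
    proof (rule fract_abs_sum_le)
      fix n assume "n \<in> {N..<2 * N}"
      then have "?\<theta> ^ n \<le> ?\<theta> ^ N"
        using \<theta>(1,2) by (intro power_decreasing) auto
      then show "fract_abs (f n) \<le> ?\<theta> ^ N" using assms[of n] by linarith
    qed (use \<theta> in simp)
    moreover have "(\<Sum>n<2 * N. f n) = (\<Sum>n<N. f n) + (\<Sum>n\<in>{N..<2 * N}. f n)"
      by (simp add: lessThan_atLeast0 sum.atLeastLessThan_concat)
    then have "s - (\<Sum>n<N. f n) = (s - (\<Sum>n<2 * N. f n)) + (\<Sum>n\<in>{N..<2 * N}. f n)"
      by simp
    ultimately show ?thesis using tail by (simp only: fract_abs_add_le)
  qed
  then show ?thesis by (rule that)
qed

section \<open>The exponent of p in a factorial\<close>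

text \<open>Between two consecutive multiples of \<open>p\<close> the factorial acquires no new factor \<open>p\<close>.\<close>

lemma multiplicity_fact_mult_add:
  fixes p :: nat
  assumes p: "Factorial_Ring.prime p" and "r < p"
  shows "multiplicity p (fact (p * q + r) :: nat) = multiplicity p (fact (p * q) :: nat)"
  using assms(2)
proof (induction r)
  case (Suc r)
  have "\<not> p dvd p * q + Suc r"
    using Suc.prems by (metis dvd_add_right_iff dvd_triv_left nat_dvd_not_less zero_less_Suc)
  then have "multiplicity p (p * q + Suc r) = 0"
    by (rule not_dvd_imp_multiplicity_0)
  moreover have "(fact (p * q + Suc r) :: nat) = (p * q + Suc r) * fact (p * q + r)"
    unfolding add_Suc_right fact_Suc by simp
  ultimately show ?case
    using Suc p by (simp add: prime_elem_multiplicity_mult_distrib del: add_Suc_right fact_Suc)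
qed simp

lemma multiplicity_fact_mult:
  fixes p :: nat
  assumes p: "Factorial_Ring.prime p"
  shows "multiplicity p (fact (p * q) :: nat) = q + multiplicity p (fact q :: nat)"
proof (induction q)
  case (Suc q)
  have "p > 0" using p by (simp add: prime_gt_0_nat)
  then have eq: "p * Suc q = Suc (p * q + (p - 1))" by simp
  have "(fact (p * Suc q) :: nat) = p * Suc q * fact (p * q + (p - 1))"
    unfolding eq fact_Suc by simp
  then have "multiplicity p (fact (p * Suc q) :: nat) = 1 + multiplicity p (Suc q) + multiplicity p (fact (p * q) :: nat)"
    using p \<open>p > 0\<close> multiplicity_fact_mult_add[OF p, of "p - 1" q]
    by (simp add: prime_elem_multiplicity_mult_distrib del: mult_Suc_right fact_Suc)
  moreover have "multiplicity p (fact (Suc q) :: nat) = multiplicity p (Suc q) + multiplicity p (fact q :: nat)"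
    using p by (simp add: fact_Suc prime_elem_multiplicity_mult_distrib del: mult_Suc)
  ultimately show ?case using Suc by simp
qed simp

text \<open>With \<open>q\<close> the number of multiples of \<open>p\<close> up to \<open>m\<close>, the exponent of \<open>p\<close> in \<open>m!\<close> is \<open>q\<close> plus the exponent in \<open>q!\<close>,
  inductively at most \<open>q + (q - 1) / 2 = (3 q - 1) / 2 \<le> (m - 1) / 2\<close>.\<close>

lemma twice_multiplicity_fact_le:
  fixes p :: nat
  assumes p: "Factorial_Ring.prime p" "3 \<le> p"
  shows "2 * multiplicity p (fact (Suc n) :: nat) \<le> n"
proof (induction n rule: less_induct)
  case (less n)
  define q where "q = Suc n div p"
  have n: "Suc n = p * q + Suc n mod p" by (simp add: q_def)
  have "multiplicity p (fact (Suc n) :: nat) = multiplicity p (fact (p * q) :: nat)"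
    using multiplicity_fact_mult_add[OF p(1), of "Suc n mod p" q] p(2) by (subst n) simp
  then have mult: "multiplicity p (fact (Suc n) :: nat) = q + multiplicity p (fact q :: nat)"
    by (simp only: multiplicity_fact_mult[OF p(1)])
  have "3 * q \<le> p * q" using p(2) by simp
  then have q: "3 * q \<le> Suc n" using n by linarith
  show ?case
  proof (cases q)
    case 0
    then show ?thesis using mult by simp
  next
    case (Suc m)
    then have "2 * multiplicity p (fact q :: nat) \<le> m"
      using less.IH[of m] q by simp
    then show ?thesis using mult q Suc by linarith
  qed
qed

lemma fract_abs_fact_ge:
  assumes "3 \<le> CARD('p)"
  shows "padic_rate TYPE('p) ^ n \<le> fract_abs (of_nat (fact (Suc n)) :: 'p::prime_card padic)"
proof -
  define m where "m = multiplicity CARD('p) (fact (Suc n) :: nat)"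
  have prime: "Factorial_Ring.prime CARD('p)" by (rule prime_card)
  have "\<not> CARD('p) ^ Suc m dvd (fact (Suc n) :: nat)"
    using prime prime_gt_1_nat[OF prime] unfolding m_def
    by (subst power_dvd_iff_le_multiplicity) (auto simp del: fact_Suc)
  then have "\<not> int CARD('p) ^ Suc m dvd int (fact (Suc n))"
    by (metis of_nat_dvd_iff of_nat_power)
  then have "padic_residue (of_nat (fact (Suc n)) :: 'p padic_int) (Suc m) \<noteq> 0"
    by (simp add: padic_residue_of_nat dvd_eq_mod_eq_0 del: fact_Suc of_nat_fact)
  then have "1 / real CARD('p) ^ m \<le> vabs (of_nat (fact (Suc n)) :: 'p padic_int)"
    by (rule vabs_ge_of_residue)
  also have "\<dots> = fract_abs (of_nat (fact (Suc n)) :: 'p padic)"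
    by (simp only: fract_abs_to_fract[symmetric] of_nat_fract to_fract_def)
  finally have "padic_rate TYPE('p) ^ (2 * m) \<le> fract_abs (of_nat (fact (Suc n)) :: 'p padic)"
    by (simp only: padic_rate(4))
  moreover have "padic_rate TYPE('p) ^ n \<le> padic_rate TYPE('p) ^ (2 * m)"
    using twice_multiplicity_fact_le[OF prime assms, of n] padic_rate(1,2)[where 'p='p]
    unfolding m_def by (intro power_decreasing) auto
  ultimately show ?thesis by linarith
qed

section \<open>Convergence of the Weierstrass series\<close>

lemma evaluates_to_exists:
  fixes f :: "'p::prime_card padic fps"
  assumes "\<And>n. fract_abs (fps_nth f n) \<le> sqrt (real CARD('p)) ^ n"
    and "fract_abs z \<le> 1 / real CARD('p)"
  obtains s where "evaluates_to (padic_rate TYPE('p)) f z s"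
proof -
  have card: "0 < real CARD('p)" using real_card_gt_1[where 'p='p] by simp
  have "fract_abs (fps_nth f n * z ^ n) \<le> padic_rate TYPE('p) ^ n" for n
  proof -
    have "fract_abs (fps_nth f n * z ^ n) \<le> sqrt (real CARD('p)) ^ n * (1 / real CARD('p)) ^ n"
      using assms by (intro fract_abs_mult_le) (auto simp: fract_abs_power intro!: power_mono fract_abs_nonneg)
    also have "\<dots> = (sqrt (real CARD('p)) * (1 / real CARD('p))) ^ n"
      by (simp only: power_mult_distrib)
    also have "sqrt (real CARD('p)) * (1 / real CARD('p)) = padic_rate TYPE('p)"
      using card by (simp add: padic_rate_def field_simps)
    finally show ?thesis .
  qed
  then obtain s where "\<And>N. fract_abs (s - (\<Sum>n<N. fps_nth f n * z ^ n)) \<le> padic_rate TYPE('p) ^ N"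
    using padic_series_converges[of "\<lambda>n. fps_nth f n * z ^ n"] by metis
  then show ?thesis
    by (intro that[of s]) (simp add: evaluates_to_def)
qed

text \<open>The coefficient of \<open>z\<^bsup>n + 1\<^esup>\<close> in \<open>t\<close> is integral after multiplication by \<open>(n + 1)!\<close>, whose absolute value is at least
  \<open>p\<^bsup>- n / 2\<^esup>\<close>.\<close>

lemma t_scaled_growth:
  fixes a b :: "'p::prime_card padic"
  assumes p: "3 \<le> CARD('p)" and "fract_abs a \<le> 1" "fract_abs b \<le> 1"
  shows "fract_abs (fps_nth (t_scaled a b) n) \<le> sqrt (real CARD('p)) ^ n"
proof -
  let ?r = "padic_rate TYPE('p) ^ n"
  have "fract_abs (of_nat (fact (Suc n)) * fps_nth (fps_X * t_scaled a b) (Suc n)) \<le> 1"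
    using hurwitz_of_hamiltonian_system[OF hamiltonian_system[of a b] _ _ assms(2,3), of "Suc n"] by (simp del: fact_Suc of_nat_fact)
  then have "fract_abs (of_nat (fact (Suc n)) :: 'p padic) * fract_abs (fps_nth (t_scaled a b) n) \<le> 1"
    by (simp add: fract_abs_mult del: fact_Suc of_nat_fact)
  moreover have "?r * fract_abs (fps_nth (t_scaled a b) n) \<le>
      fract_abs (of_nat (fact (Suc n)) :: 'p padic) * fract_abs (fps_nth (t_scaled a b) n)"
    by (intro mult_right_mono fract_abs_fact_ge p fract_abs_nonneg)
  ultimately have "?r * fract_abs (fps_nth (t_scaled a b) n) \<le> 1" by linarith
  then show ?thesis
    using real_card_gt_1[where 'p='p] by (simp add: padic_rate_def power_divide pos_divide_le_eq)
qed

lemma w_scaled_growth: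
  fixes a b :: "'p::prime_card padic"
  assumes "3 \<le> CARD('p)" and "fract_abs a \<le> 1" "fract_abs b \<le> 1"
  shows "fract_abs (fps_nth (w_scaled a b) n) \<le> sqrt (real CARD('p)) ^ n"
  by (rule growth_of_curve[OF w_scaled_curve t_scaled_growth[OF assms] assms(2,3)])
     (use real_card_gt_1[where 'p='p] in simp)

lemma wp_scaled_growth:
  fixes a b :: "'p::prime_card padic"
  assumes "3 \<le> CARD('p)" and "fract_abs a \<le> 1" "fract_abs b \<le> 1"
  shows "fract_abs (fps_nth (wp_scaled a b) n) \<le> sqrt (real CARD('p)) ^ n"
  by (rule growth_divisor[OF _ w_scaled_growth[OF assms] w_scaled_nth_0])
     (use t_scaled_growth[OF assms] in \<open>simp_all add: t_scaled_def\<close>)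

lemma wp'_scaled_growth:
  fixes a b :: "'p::prime_card padic"
  assumes "3 \<le> CARD('p)" and "fract_abs a \<le> 1" "fract_abs b \<le> 1"
  shows "fract_abs (fps_nth (wp'_scaled a b) n) \<le> sqrt (real CARD('p)) ^ n"
proof (rule growth_divisor[OF _ w_scaled_growth[OF assms] w_scaled_nth_0])
  show "fract_abs (fps_nth (wp'_scaled a b * w_scaled a b) n) \<le> sqrt (real CARD('p)) ^ n" for n
    unfolding wp'_scaled_times_w_scaled by (cases n) (simp_all add: fract_abs_minus)
qed simp

lemma evaluates_to_imp_tendsto:
  fixes z :: "'a::valued_idom fract"
  assumes f: "evaluates_to \<theta> f z s" and \<theta>: "0 \<le> \<theta>" "\<theta> < 1"
  shows "(\<lambda>L. ((\<Sum>n<2 * L + 4. fps_nth f n * z ^ n) + c) * d) \<longlonglongrightarrow> (s + c) * d"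
proof (rule metric_LIMSEQ_I)
  fix e :: real assume "0 < e"
  have d0: "0 \<le> fract_abs d" by (rule fract_abs_nonneg)
  obtain N where N: "\<theta> ^ N < e / (fract_abs d + 1)"
    using \<open>0 < e\<close> \<theta> d0 real_arch_pow_inv[of "e / (fract_abs d + 1)" \<theta>] by (auto simp: add_nonneg_pos)
  show "\<exists>N. \<forall>L\<ge>N. dist (((\<Sum>n<2 * L + 4. fps_nth f n * z ^ n) + c) * d) ((s + c) * d) < e"
  proof (intro exI[of _ N] allI impI)
    fix L assume "N \<le> L"
    let ?S = "\<Sum>n<2 * L + 4. fps_nth f n * z ^ n"
    have "dist ((?S + c) * d) ((s + c) * d) = fract_abs (- ((s - ?S) * d))"
      by (simp add: dist_fract_def algebra_simps)
    also have "\<dots> = fract_abs (s - ?S) * fract_abs d"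
      by (simp only: fract_abs_minus fract_abs_mult)
    also have "\<dots> \<le> \<theta> ^ (2 * L + 4) * fract_abs d"
      by (intro mult_right_mono evaluates_toD[OF f] d0)
    also have "\<dots> \<le> \<theta> ^ N * (fract_abs d + 1)"
      using \<theta> \<open>N \<le> L\<close> d0 by (intro mult_mono power_decreasing) auto
    also have "\<dots> < e"
      using N d0 by (simp add: pos_less_divide_eq)
    finally show "dist ((?S + c) * d) ((s + c) * d) < e" .
  qed
qed

lemma sum_lessThan_two_more:
  "(\<Sum>n<2 * Suc L + 4. f n) = (\<Sum>n<2 * L + 4. f n) + f (2 * L + 4) + (f (2 * L + 5) :: 'a::comm_monoid_add)"
proof -
  have "{..<2 * Suc L + 4} = insert (2 * L + 5) (insert (2 * L + 4) {..<2 * L + 4})" by auto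
  then show ?thesis by (simp add: ac_simps)
qed

lemma add_scaled_term:
  fixes A B S c d :: "'a::comm_ring_1"
  assumes "A * d = B"
  shows "(S + c) * d + B = (S + A + c) * d"
  by (simp add: assms[symmetric] algebra_simps)

text \<open>The series defining \<open>wp\<close> runs over the even degrees only, so its \<open>L\<close>-th partial sum is
  a partial sum of the scaled series of length \<open>2 L + 4\<close> with the constant term removed.\<close>

lemma wp_partial_sum:
  fixes a b z :: "'a::field_char_0"
  assumes "z \<noteq> 0"
  shows "(\<Sum>l<L. wp_coeff a b (l + 2) * z ^ (2 * (l + 2) - 2)) =
    ((\<Sum>n<2 * L + 4. fps_nth (wp_scaled a b) n * z ^ n) + (- 1)) * (1 / z ^ 2)"
proof (induction L)
  case 0
  have "fps_nth (wp_scaled a b) 0 = 1" "fps_nth (wp_scaled a b) 1 = 0" "fps_nth (wp_scaled a b) 2 = 0"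
      "fps_nth (wp_scaled a b) 3 = 0"
    by (simp_all add: wp_scaled_def fps_X_power_mult_nth wp_regular_def wp_coeff_small)
  moreover have "{..<4::nat} = {0, 1, 2, 3}" by auto
  ultimately show ?case by simp
next
  case (Suc L)
  have nth: "fps_nth (wp_scaled a b) (2 * L + 4) = wp_coeff a b (L + 2)" "fps_nth (wp_scaled a b) (2 * L + 5) = 0"
    by (simp_all add: wp_scaled_def fps_X_power_mult_nth wp_regular_def)
  have "(\<Sum>n<2 * Suc L + 4. fps_nth (wp_scaled a b) n * z ^ n) =
      (\<Sum>n<2 * L + 4. fps_nth (wp_scaled a b) n * z ^ n) + wp_coeff a b (L + 2) * z ^ (2 * L + 4)"
    unfolding sum_lessThan_two_more nth by simp
  moreover have "wp_coeff a b (L + 2) * z ^ (2 * L + 4) * (1 / z ^ 2) = wp_coeff a b (L + 2) * z ^ (2 * (L + 2) - 2)"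
  proof -
    have "z ^ (2 * L + 4) = z ^ ((2 * (L + 2) - 2) + 2)" by (rule arg_cong) simp
    also have "\<dots> = z ^ (2 * (L + 2) - 2) * z ^ 2" by (rule power_add)
    finally have "z ^ (2 * L + 4) = z ^ (2 * (L + 2) - 2) * z ^ 2" .
    then show ?thesis using assms by simp
  qed
  ultimately show ?case
    unfolding sum.lessThan_Suc[of _ L] Suc.IH by (simp only: add_scaled_term)
qed

lemma wp'_partial_sum:
  fixes a b z :: "'a::field_char_0"
  assumes "z \<noteq> 0"
  shows "(\<Sum>l<L. of_nat (2 * (l + 2) - 2) * wp_coeff a b (l + 2) * z ^ (2 * (l + 2) - 3)) =
    ((\<Sum>n<2 * L + 4. fps_nth (wp'_scaled a b) n * z ^ n) + 1) * (2 / z ^ 3)"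
proof (induction L)
  case 0
  have "fps_nth (wp'_scaled a b) 0 = - 1" "fps_nth (wp'_scaled a b) 1 = 0" "fps_nth (wp'_scaled a b) 2 = 0"
      "fps_nth (wp'_scaled a b) 3 = 0"
    by (simp_all add: wp'_scaled_def fps_X_power_mult_nth wp_regular_def mult.assoc)
  moreover have "{..<4::nat} = {0, 1, 2, 3}" by auto
  ultimately show ?case by simp
next
  case (Suc L)
  have nth: "fps_nth (wp'_scaled a b) (2 * L + 4) = of_nat (2 * L + 2) / 2 * wp_coeff a b (L + 2)"
      "fps_nth (wp'_scaled a b) (2 * L + 5) = 0"
    by (simp_all add: wp'_scaled_def fps_X_power_mult_nth wp_regular_def mult.assoc algebra_simps)
  have "(\<Sum>n<2 * Suc L + 4. fps_nth (wp'_scaled a b) n * z ^ n) =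
      (\<Sum>n<2 * L + 4. fps_nth (wp'_scaled a b) n * z ^ n) + of_nat (2 * L + 2) / 2 * wp_coeff a b (L + 2) * z ^ (2 * L + 4)"
    unfolding sum_lessThan_two_more nth by simp
  moreover have "of_nat (2 * L + 2) / 2 * wp_coeff a b (L + 2) * z ^ (2 * L + 4) * (2 / z ^ 3) =
      of_nat (2 * (L + 2) - 2) * wp_coeff a b (L + 2) * z ^ (2 * (L + 2) - 3)"
  proof -
    have "z ^ (2 * L + 4) = z ^ ((2 * (L + 2) - 3) + 3)" by (rule arg_cong) simp
    also have "\<dots> = z ^ (2 * (L + 2) - 3) * z ^ 3" by (rule power_add)
    finally have "z ^ (2 * L + 4) = z ^ (2 * (L + 2) - 3) * z ^ 3" .
    moreover have "2 * L + 2 = 2 * (L + 2) - 2" by simp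
    ultimately show ?thesis using assms by (simp only:) simp
  qed
  ultimately show ?case
    unfolding sum.lessThan_Suc[of _ L] Suc.IH by (simp only: add_scaled_term)
qed

lemma wp_eq:
  fixes a b z :: "'p::prime_card padic"
  assumes "evaluates_to (padic_rate TYPE('p)) (wp_scaled a b) z P" and "z \<noteq> 0"
  shows "wp a b z = P / z ^ 2"
proof -
  have "(\<lambda>l. wp_coeff a b (l + 2) * z ^ (2 * (l + 2) - 2)) sums ((P + (- 1)) * (1 / z ^ 2))"
    unfolding sums_def wp_partial_sum[OF assms(2)]
    using padic_rate(1,2)[where 'p='p] by (intro evaluates_to_imp_tendsto[OF assms(1)]) auto
  then have "(\<Sum>l. wp_coeff a b (l + 2) * z ^ (2 * (l + 2) - 2)) = (P + (- 1)) * (1 / z ^ 2)"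
    by (rule sums_unique[symmetric])
  then show ?thesis
    unfolding wp_def using assms(2) by (simp only:) (simp add: field_simps)
qed

lemma wp'_eq:
  fixes a b z :: "'p::prime_card padic"
  assumes "evaluates_to (padic_rate TYPE('p)) (wp'_scaled a b) z Q" and "z \<noteq> 0"
  shows "1 / 2 * wp' a b z = Q / z ^ 3"
proof -
  have "(\<lambda>l. of_nat (2 * (l + 2) - 2) * wp_coeff a b (l + 2) * z ^ (2 * (l + 2) - 3)) sums ((Q + 1) * (2 / z ^ 3))"
    unfolding sums_def wp'_partial_sum[OF assms(2)]
    using padic_rate(1,2)[where 'p='p] by (intro evaluates_to_imp_tendsto[OF assms(1)]) auto
  then have "(\<Sum>l. of_nat (2 * (l + 2) - 2) * wp_coeff a b (l + 2) * z ^ (2 * (l + 2) - 3)) = (Q + 1) * (2 / z ^ 3)"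
    by (rule sums_unique[symmetric])
  then show ?thesis
    unfolding wp'_def using assms(2) by (simp only:) (simp add: field_simps)
qed

section \<open>Points of the projective plane\<close>

lemma proj_point_scale:
  assumes "monoid R" and u: "u \<in> Units R" and "Z \<in> carrier R" "X \<in> carrier R" "Y \<in> carrier R"
  shows "proj_point R (u \<otimes>\<^bsub>R\<^esub> Z, u \<otimes>\<^bsub>R\<^esub> X, u \<otimes>\<^bsub>R\<^esub> Y) = proj_point R (Z, X, Y)"
proof -
  interpret monoid R by fact
  have 1: "\<exists>v'. v' \<in> Units R \<and> v \<otimes>\<^bsub>R\<^esub> (u \<otimes>\<^bsub>R\<^esub> Z) = v' \<otimes>\<^bsub>R\<^esub> Z \<and> v \<otimes>\<^bsub>R\<^esub> (u \<otimes>\<^bsub>R\<^esub> X) = v' \<otimes>\<^bsub>R\<^esub> X \<and>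
      v \<otimes>\<^bsub>R\<^esub> (u \<otimes>\<^bsub>R\<^esub> Y) = v' \<otimes>\<^bsub>R\<^esub> Y" if "v \<in> Units R" for v
    using that assms by (intro exI[of _ "v \<otimes>\<^bsub>R\<^esub> u"]) (simp add: m_assoc Units_closed)
  have 2: "\<exists>v'. v' \<in> Units R \<and> v \<otimes>\<^bsub>R\<^esub> Z = v' \<otimes>\<^bsub>R\<^esub> (u \<otimes>\<^bsub>R\<^esub> Z) \<and> v \<otimes>\<^bsub>R\<^esub> X = v' \<otimes>\<^bsub>R\<^esub> (u \<otimes>\<^bsub>R\<^esub> X) \<and>
      v \<otimes>\<^bsub>R\<^esub> Y = v' \<otimes>\<^bsub>R\<^esub> (u \<otimes>\<^bsub>R\<^esub> Y)" if "v \<in> Units R" for v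
  proof (intro exI[of _ "v \<otimes>\<^bsub>R\<^esub> inv\<^bsub>R\<^esub> u"] conjI)
    have "(v \<otimes>\<^bsub>R\<^esub> inv\<^bsub>R\<^esub> u) \<otimes>\<^bsub>R\<^esub> (u \<otimes>\<^bsub>R\<^esub> x) = v \<otimes>\<^bsub>R\<^esub> x" if "x \<in> carrier R" for x
    proof -
      have "(v \<otimes>\<^bsub>R\<^esub> inv\<^bsub>R\<^esub> u) \<otimes>\<^bsub>R\<^esub> (u \<otimes>\<^bsub>R\<^esub> x) = v \<otimes>\<^bsub>R\<^esub> ((inv\<^bsub>R\<^esub> u \<otimes>\<^bsub>R\<^esub> u) \<otimes>\<^bsub>R\<^esub> x)"
        using \<open>v \<in> Units R\<close> u that by (simp only: m_assoc Units_closed Units_inv_closed m_closed)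
      then show ?thesis using \<open>v \<in> Units R\<close> u that by (simp add: Units_closed)
    qed
    then show "v \<otimes>\<^bsub>R\<^esub> Z = v \<otimes>\<^bsub>R\<^esub> inv\<^bsub>R\<^esub> u \<otimes>\<^bsub>R\<^esub> (u \<otimes>\<^bsub>R\<^esub> Z)" "v \<otimes>\<^bsub>R\<^esub> X = v \<otimes>\<^bsub>R\<^esub> inv\<^bsub>R\<^esub> u \<otimes>\<^bsub>R\<^esub> (u \<otimes>\<^bsub>R\<^esub> X)"
      "v \<otimes>\<^bsub>R\<^esub> Y = v \<otimes>\<^bsub>R\<^esub> inv\<^bsub>R\<^esub> u \<otimes>\<^bsub>R\<^esub> (u \<otimes>\<^bsub>R\<^esub> Y)"
      using assms(3-5) by simp_all
  qed (use that u in simp)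
  show ?thesis
    unfolding proj_point_def prod.case
  proof (intro equalityI subsetI)
    fix P assume "P \<in> {(v \<otimes>\<^bsub>R\<^esub> (u \<otimes>\<^bsub>R\<^esub> Z), v \<otimes>\<^bsub>R\<^esub> (u \<otimes>\<^bsub>R\<^esub> X), v \<otimes>\<^bsub>R\<^esub> (u \<otimes>\<^bsub>R\<^esub> Y)) |v. v \<in> Units R}"
    then obtain v where v: "v \<in> Units R" and P: "P = (v \<otimes>\<^bsub>R\<^esub> (u \<otimes>\<^bsub>R\<^esub> Z), v \<otimes>\<^bsub>R\<^esub> (u \<otimes>\<^bsub>R\<^esub> X), v \<otimes>\<^bsub>R\<^esub> (u \<otimes>\<^bsub>R\<^esub> Y))"
      by blast
    show "P \<in> {(v \<otimes>\<^bsub>R\<^esub> Z, v \<otimes>\<^bsub>R\<^esub> X, v \<otimes>\<^bsub>R\<^esub> Y) |v. v \<in> Units R}"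
      using 1[OF v] unfolding P by blast
  next
    fix P assume "P \<in> {(v \<otimes>\<^bsub>R\<^esub> Z, v \<otimes>\<^bsub>R\<^esub> X, v \<otimes>\<^bsub>R\<^esub> Y) |v. v \<in> Units R}"
    then obtain v where v: "v \<in> Units R" and P: "P = (v \<otimes>\<^bsub>R\<^esub> Z, v \<otimes>\<^bsub>R\<^esub> X, v \<otimes>\<^bsub>R\<^esub> Y)"
      by blast
    show "P \<in> {(v \<otimes>\<^bsub>R\<^esub> (u \<otimes>\<^bsub>R\<^esub> Z), v \<otimes>\<^bsub>R\<^esub> (u \<otimes>\<^bsub>R\<^esub> X), v \<otimes>\<^bsub>R\<^esub> (u \<otimes>\<^bsub>R\<^esub> Y)) |v. v \<in> Units R}"
      using 2[OF v] unfolding P by blast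
  qed
qed

text \<open>Representatives of a point that agree in a coordinate which is a unit are equal, since the scaling factor
  between them is 1.\<close>

lemma proj_point_eq_imp:
  assumes "monoid R" and eq: "proj_point R (Z, X, Y) = proj_point R (Z', X', Y)"
    and car: "Z \<in> carrier R" "X \<in> carrier R" "Z' \<in> carrier R" "X' \<in> carrier R" and Y: "Y \<in> Units R"
  shows "Z = Z' \<and> X = X'"
proof -
  interpret monoid R by fact
  have "(Z, X, Y) \<in> proj_point R (Z, X, Y)"
    using car Y unfolding proj_point_def by (auto intro!: exI[of _ "\<one>\<^bsub>R\<^esub>"])
  then obtain u where u: "u \<in> Units R" "Z = u \<otimes>\<^bsub>R\<^esub> Z'" "X = u \<otimes>\<^bsub>R\<^esub> X'" "Y = u \<otimes>\<^bsub>R\<^esub> Y"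
    unfolding eq by (auto simp: proj_point_def)
  have "u \<otimes>\<^bsub>R\<^esub> (Y \<otimes>\<^bsub>R\<^esub> inv\<^bsub>R\<^esub> Y) = Y \<otimes>\<^bsub>R\<^esub> inv\<^bsub>R\<^esub> Y"
    using u(1,4) Y by (metis Units_closed Units_inv_closed m_assoc)
  then have "u = \<one>\<^bsub>R\<^esub>" using u(1) Y by (simp add: Units_closed)
  then show ?thesis using u car by simp
qed

lemma mult_ring_of_type_algebra: "x \<otimes>\<^bsub>ring_of_type_algebra\<^esub> y = (x * y :: 'a::ring_1)"
  by (simp add: ring_of_type_algebra_def)

lemma carrier_ring_of_type_algebra: "carrier (ring_of_type_algebra :: 'a::ring_1 ring) = UNIV"
  by (simp add: ring_of_type_algebra_def)

lemma Units_ring_of_type_algebra: "Units (ring_of_type_algebra :: 'a::field ring) = {u. u \<noteq> 0}"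
proof -
  have "\<exists>y. y * x = 1 \<and> x * y = 1" if "x \<noteq> 0" for x :: 'a
    using that by (intro exI[of _ "inverse x"]) simp
  then show ?thesis
    unfolding Units_def mult_ring_of_type_algebra carrier_ring_of_type_algebra
    by (auto simp: ring_of_type_algebra_def)
qed

lemma mem_proj_point_field:
  "(z, x, y) \<in> proj_point (ring_of_type_algebra :: 'a::field ring) (Z, X, Y) \<longleftrightarrow>
    (\<exists>u. u \<noteq> 0 \<and> z = u * Z \<and> x = u * X \<and> y = u * Y)"
  unfolding proj_point_def prod.case mult_ring_of_type_algebra Units_ring_of_type_algebra mem_Collect_eq Pair_inject
  by (simp add: conj_ac)

lemma proj_point_field_scale:
  assumes "(c :: 'a::field) \<noteq> 0"
  shows "proj_point ring_of_type_algebra (c * Z, c * X, c * Y) = proj_point ring_of_type_algebra (Z, X, Y)"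
proof -
  have "cring (ring_of_type_algebra :: 'a ring)" by (rule cring_from_type_algebra)
  then have "Group.monoid (ring_of_type_algebra :: 'a ring)"
    by (rule Ring.cring.axioms(1)[THEN Ring.ring.axioms(2)])
  then have "proj_point (ring_of_type_algebra :: 'a ring) (c \<otimes>\<^bsub>ring_of_type_algebra\<^esub> Z,
      c \<otimes>\<^bsub>ring_of_type_algebra\<^esub> X, c \<otimes>\<^bsub>ring_of_type_algebra\<^esub> Y) = proj_point ring_of_type_algebra (Z, X, Y)"
    by (rule proj_point_scale) (simp_all add: Units_ring_of_type_algebra carrier_ring_of_type_algebra assms)
  then show ?thesis
    by (simp only: mult_ring_of_type_algebra)
qed

section \<open>The residue characteristic\<close>

text \<open>In characteristic 2 the point with \<open>x\<^sup>2 = a\<close> and \<open>y\<^sup>2 = b\<close> is singular.\<close>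

lemma nonsingular_weierstrass_imp_odd:
  assumes "nonsingular_weierstrass (a :: 'p::prime_card mod_ring) b"
  shows "3 \<le> CARD('p)"
proof (rule ccontr)
  assume "\<not> 3 \<le> CARD('p)"
  then have "CARD('p) = 2"
    using prime_ge_2_nat[OF prime_card[where 'a='p]] by simp
  then have "(2 :: 'p mod_ring) = 0"
    using of_nat_card_eq_0[where 'a='p] by simp
  then have 2: "(2 :: 'p mod_ring alg_closure) = 0"
    by (metis to_ac_0 to_ac_numeral)
  obtain X where X: "X ^ 2 = to_ac a"
    using nth_root_exists[of 2 "to_ac a"] by auto
  obtain Y where Y: "Y ^ 2 = to_ac b"
    using nth_root_exists[of 2 "to_ac b"] by auto
  have X3: "X ^ 3 = to_ac a * X"
    by (simp add: X[symmetric] power2_eq_square power3_eq_cube)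
  have "Y ^ 2 * 1 - X ^ 3 - to_ac a * X * 1 ^ 2 - to_ac b * 1 ^ 3 = - (2 * (to_ac a * X))"
    by (simp add: Y X3)
  moreover have "Y ^ 2 - 2 * to_ac a * X * 1 - 3 * to_ac b * 1 ^ 2 = - (2 * (to_ac a * X)) - 2 * to_ac b"
    by (simp add: Y)
  moreover have "- 3 * X ^ 2 - to_ac a * 1 ^ 2 = - (2 * (2 * to_ac a))"
    by (simp add: X)
  ultimately have "\<exists>Z X Y :: 'p mod_ring alg_closure. (Z, X, Y) \<noteq> (0, 0, 0) \<and>
        Y ^ 2 * Z - X ^ 3 - to_ac a * X * Z ^ 2 - to_ac b * Z ^ 3 = 0 \<and>
        Y ^ 2 - 2 * to_ac a * X * Z - 3 * to_ac b * Z ^ 2 = 0 \<and>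
        - 3 * X ^ 2 - to_ac a * Z ^ 2 = 0 \<and>
        2 * Y * Z = 0"
    by (intro exI[of _ 1] exI[of _ X] exI[of _ Y] conjI) (simp_all add: 2)
  then show False
    using assms unfolding nonsingular_weierstrass_def by (rule notE[rotated])
qed

section \<open>The exponential in the coordinates at infinity\<close>

lemma curve_difference:
  fixes a b t t' w w' :: "'a::comm_ring_1"
  assumes "w = t ^ 3 + a * t * w ^ 2 + b * w ^ 3" and "w' = t' ^ 3 + a * t' * w' ^ 2 + b * w' ^ 3"
  shows "(w - w') * (1 - (a * t' * (w + w') + b * (w ^ 2 + w * w' + w' ^ 2))) =
    (t - t') * (t ^ 2 + t * t' + t' ^ 2 + a * w ^ 2)"
proof -
  have "(w - w') * (1 - (a * t' * (w + w') + b * (w ^ 2 + w * w' + w' ^ 2))) =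
      w - w' - a * t' * (w ^ 2 - w' ^ 2) - b * (w ^ 3 - w' ^ 3)"
    by (simp add: algebra_simps power2_eq_square power3_eq_cube)
  also have "\<dots> = (t - t') * (t ^ 2 + t * t' + t' ^ 2 + a * w ^ 2)"
  proof -
    have "w - w' = (t ^ 3 + a * t * w ^ 2 + b * w ^ 3) - (t' ^ 3 + a * t' * w' ^ 2 + b * w' ^ 3)"
      using assms by simp
    then show ?thesis
      by (simp only:) (simp add: algebra_simps power2_eq_square power3_eq_cube)
  qed
  finally show ?thesis .
qed

lemma one_minus_unit:
  assumes "of_nat CARD('p) dvd (y :: 'p::prime_card padic_int)"
  shows "(1 - y) dvd 1"
proof (rule padic_unit_of_residue)
  have "padic_residue y 1 = 0"
    using assms power_dvd_iff_residue[of 1 y] by simp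
  then show "padic_residue (1 - y) 1 \<noteq> 0"
    using card_gt_1[where 'p='p] by (simp add: padic_residue_diff padic_residue_one)
qed

text \<open>The difference of the two equations is \<open>(w - w') u = (t - t') v\<close>, where \<open>u\<close> is a unit because \<open>w\<close> and \<open>w'\<close> are
  divisible by \<open>p\<close>.\<close>

lemma curve_congruence:
  fixes a b t t' w w' :: "'p::prime_card padic_int"
  assumes "w = t ^ 3 + a * t * w ^ 2 + b * w ^ 3" and "w' = t' ^ 3 + a * t' * w' ^ 2 + b * w' ^ 3"
    and "of_nat CARD('p) dvd w" and "of_nat CARD('p) dvd w'" and d: "d dvd t - t'"
  shows "d dvd w - w'"
proof -
  let ?y = "a * t' * (w + w') + b * (w ^ 2 + w * w' + w' ^ 2)"
  have "of_nat CARD('p) dvd ?y"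
    using assms(3,4) by (intro dvd_add dvd_mult) (simp_all add: power2_eq_square)
  then have "1 - ?y dvd 1" by (rule one_minus_unit)
  then obtain c where c: "1 = (1 - ?y) * c" ..
  have "d dvd (w - w') * (1 - ?y) * c"
    using d by (simp add: curve_difference[OF assms(1,2)])
  then show ?thesis
    by (simp only: mult.assoc[of "w - w'" "1 - ?y" c] c[symmetric] mult_1_right)
qed

lemma vabs_le_of_dvd: "of_nat CARD('p) dvd (x :: 'p::prime_card padic_int) \<longleftrightarrow> vabs x \<le> 1 / real CARD('p)"
  using power_dvd_iff_residue[of 1 x] vabs_le_iff_residue[of x 1] by simp

text \<open>The identities between the formal series are evaluated at \<open>x\<close>. The homogeneous coordinates
  \<open>[1 : \<wp> : \<wp>' / 2]\<close> are then multiplied by \<open>w = - 2 / \<wp>'\<close>, which is not zero if \<open>x\<close> is not; at \<open>x = 0\<close> the formula gives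
  \<open>[0 : 0 : - 1] = \<Omega>\<close>. The value \<open>s\<close> of \<open>t / z\<close> is kept in the conclusion for the comparison of two points.\<close>

lemma exp_point_coordinates:
  fixes a b x :: "'p::prime_card padic_int"
  assumes p: "3 \<le> CARD('p)" and x: "of_nat CARD('p) dvd x"
  obtains w t s where
    "evaluates_to (padic_rate TYPE('p)) (t_scaled (to_fract a) (to_fract b)) (to_fract x) s"
    "to_fract t = to_fract x * s" "of_nat CARD('p) dvd w"
    "w = t ^ 3 + a * t * w ^ 2 + b * w ^ 3"
    "exp_point a b x = proj_point ring_of_type_algebra (to_fract w, to_fract t, - 1)"
proof -
  define z where "z = to_fract x"
  define A where "A = to_fract a"
  define B where "B = to_fract b"
  let ?ev = "evaluates_to (padic_rate TYPE('p))"
  have ab: "fract_abs A \<le> 1" "fract_abs B \<le> 1"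
    by (simp_all add: A_def B_def fract_abs_to_fract vabs_padic_int_le_1)
  have z: "fract_abs z \<le> 1 / real CARD('p)"
    using x by (simp add: z_def fract_abs_to_fract vabs_le_of_dvd)
  have \<theta>: "0 \<le> padic_rate TYPE('p)" "padic_rate TYPE('p) < 1" "padic_rate TYPE('p) \<le> 1"
    using padic_rate(1,2)[where 'p='p] by simp_all
  have z1: "fract_abs z \<le> 1"
    by (simp add: z_def fract_abs_to_fract vabs_padic_int_le_1)
  have zr: "fract_abs z \<le> padic_rate TYPE('p)"
    using z padic_rate(3)[where 'p='p] \<theta> power_decreasing[of 1 2 "padic_rate TYPE('p)"] by simp
  obtain T where T: "?ev (t_scaled A B) z T"
    using evaluates_to_exists[OF t_scaled_growth[OF p ab] z] .
  obtain W where W: "?ev (w_scaled A B) z W"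
    using evaluates_to_exists[OF w_scaled_growth[OF p ab] z] .
  obtain P where P: "?ev (wp_scaled A B) z P"
    using evaluates_to_exists[OF wp_scaled_growth[OF p ab] z] .
  obtain Q where Q: "?ev (wp'_scaled A B) z Q"
    using evaluates_to_exists[OF wp'_scaled_growth[OF p ab] z] .
  note eval = evaluates_to_add evaluates_to_mult[OF _ _ \<theta>(1,3)] evaluates_to_power[OF _ \<theta>(1,3)]
    evaluates_to_const[OF ab(1) \<theta>(1)] evaluates_to_const[OF ab(2) \<theta>(1)] evaluates_to_fps_X[OF zr \<theta>(3)]
  have PW: "P * W = T"
    using evaluates_to_mult[OF P W \<theta>(1,3)] T \<theta>(1,2) unfolding t_scaled_def by (rule evaluates_to_unique)
  have "?ev (wp'_scaled A B * w_scaled A B) z (- 1)"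
    unfolding wp'_scaled_times_w_scaled using evaluates_to_const[of "- 1" "padic_rate TYPE('p)" z] \<theta>(1)
    by (simp add: fract_abs_minus flip: fps_const_neg)
  then have QW: "Q * W = - 1"
    using evaluates_to_mult[OF Q W \<theta>(1,3)] \<theta>(1,2) by (metis evaluates_to_unique)
  have "?ev (t_scaled A B ^ 3 + fps_const A * fps_X ^ 4 * (t_scaled A B * w_scaled A B ^ 2)
      + fps_const B * fps_X ^ 6 * w_scaled A B ^ 3) z
      (T ^ 3 + A * z ^ 4 * (T * W ^ 2) + B * z ^ 6 * W ^ 3)"
    by (intro eval T W)
  then have curve: "W = T ^ 3 + A * z ^ 4 * (T * W ^ 2) + B * z ^ 6 * W ^ 3"
    using W \<theta>(1,2) unfolding w_scaled_curve[of A B, symmetric] by (metis evaluates_to_unique)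
  have le1: "fract_abs T \<le> 1" "fract_abs W \<le> 1"
    using evaluates_to_le_1[OF T] evaluates_to_le_1[OF W] .
  obtain t where t: "z * T = to_fract t"
    using padic_int_of_fract_abs_le_1[OF fract_abs_mult_le_1[OF z1 le1(1)]] .
  have z2: "fract_abs (z ^ 2) \<le> 1"
    unfolding power2_eq_square by (rule fract_abs_mult_le_1[OF z1 z1])
  have w_le: "fract_abs (z * (z ^ 2 * W)) \<le> 1 / real CARD('p) * 1"
    by (intro fract_abs_mult_le z fract_abs_mult_le_1 z2 le1)
  obtain w where w: "z * (z ^ 2 * W) = to_fract w"
    using padic_int_of_fract_abs_le_1[OF fract_abs_mult_le_1[OF z1 fract_abs_mult_le_1[OF z2 le1(2)]]] .
  have w3: "to_fract w = z ^ 3 * W"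
    by (simp add: w[symmetric] power2_eq_square power3_eq_cube)
  show ?thesis
  proof (rule that)
    show "?ev (t_scaled (to_fract a) (to_fract b)) (to_fract x) T"
      using T by (simp add: A_def B_def z_def)
    show "to_fract t = to_fract x * T"
      using t by (simp add: z_def)
    show "of_nat CARD('p) dvd w"
      using w_le by (simp add: w fract_abs_to_fract vabs_le_of_dvd)
    have "z ^ 3 * W = z ^ 3 * (T ^ 3 + A * z ^ 4 * (T * W ^ 2) + B * z ^ 6 * W ^ 3)"
      using curve by simp
    also have "\<dots> = (z * T) ^ 3 + A * (z * T) * (z ^ 3 * W) ^ 2 + B * (z ^ 3 * W) ^ 3"
      by (simp add: eval_nat_numeral algebra_simps)
    finally have "to_fract w = to_fract (t ^ 3 + a * t * w ^ 2 + b * w ^ 3)"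
      unfolding w3[symmetric] t A_def B_def by (simp add: power2_eq_square power3_eq_cube)
    then show "w = t ^ 3 + a * t * w ^ 2 + b * w ^ 3"
      by (simp only: to_fract_eq_iff)
    show "exp_point a b x = proj_point ring_of_type_algebra (to_fract w, to_fract t, - 1)"
    proof (cases "x = 0")
      case True
      then have "to_fract w = 0" "to_fract t = 0"
        using t w3 by (simp_all add: z_def)
      then show ?thesis
        using True proj_point_field_scale[of "- 1 :: 'p padic" 0 0 1] by (simp add: exp_point_def)
    next
      case False
      then have z0: "z \<noteq> 0" by (simp add: z_def)
      have W0: "W \<noteq> 0" using QW by auto
      have "exp_point a b x = proj_point ring_of_type_algebra (1, P / z ^ 2, Q / z ^ 3)"
        using False wp_eq[OF P z0] wp'_eq[OF Q z0] by (simp add: exp_point_def A_def B_def z_def)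
      also have "\<dots> = proj_point ring_of_type_algebra (z ^ 3 * W * 1, z ^ 3 * W * (P / z ^ 2), z ^ 3 * W * (Q / z ^ 3))"
        using z0 W0 by (intro proj_point_field_scale[symmetric]) simp
      also have "z ^ 3 * W * (P / z ^ 2) = z * T"
        using z0 by (simp add: PW[symmetric] power2_eq_square power3_eq_cube)
      also have "z ^ 3 * W * (Q / z ^ 3) = - 1"
        using z0 by (simp add: QW[symmetric])
      finally show ?thesis by (simp add: w3 t)
    qed
  qed
qed

text \<open>The series \<open>t / z\<close> has constant term 1 and its other terms are less than 1 on \<open>p\<int>\<^sub>p\<close>.\<close>

lemma exp_coordinate_isometry:
  fixes a b x x' :: "'p::prime_card padic_int"
  assumes p: "3 \<le> CARD('p)" and x: "of_nat CARD('p) dvd x" "of_nat CARD('p) dvd x'"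
    and s: "evaluates_to (padic_rate TYPE('p)) (t_scaled (to_fract a) (to_fract b)) (to_fract x) s"
      "to_fract t = to_fract x * s"
    and s': "evaluates_to (padic_rate TYPE('p)) (t_scaled (to_fract a) (to_fract b)) (to_fract x') s'"
      "to_fract t' = to_fract x' * s'"
  shows "vabs (t - t') = vabs (x - x')"
proof -
  let ?f = "t_scaled (to_fract a) (to_fract b)" and ?r = "1 / real CARD('p)"
  have card: "1 < real CARD('p)" by (rule real_card_gt_1)
  have growth: "fract_abs (fps_nth ?f n) * ?r ^ n \<le> padic_rate TYPE('p) ^ n" for n
  proof -
    have "fract_abs (fps_nth ?f n) * ?r ^ n \<le> sqrt (real CARD('p)) ^ n * ?r ^ n"
      using p by (intro mult_right_mono t_scaled_growth) (simp_all add: fract_abs_to_fract vabs_padic_int_le_1)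
    also have "\<dots> = (sqrt (real CARD('p)) * ?r) ^ n"
      by (simp only: power_mult_distrib)
    also have "sqrt (real CARD('p)) * ?r = padic_rate TYPE('p)"
      using card by (simp add: padic_rate_def field_simps)
    finally show ?thesis .
  qed
  have "fract_abs (to_fract x * s - to_fract x' * s') = fract_abs (to_fract x - to_fract x')"
    using x card padic_rate(1,2)[where 'p='p]
    by (intro evaluates_to_isometry[OF s(1) s'(1) t_scaled_nth_0 growth])
       (simp_all add: fract_abs_to_fract vabs_le_of_dvd)
  then show ?thesis
    by (simp flip: s(2) s'(2) to_fract_diff add: fract_abs_to_fract)
qed

section \<open>Reduction modulo a power of p\<close>

lemma residues_card_power: "1 \<le> k \<Longrightarrow> residues (int CARD('p::prime_card) ^ k)"
  using card_gt_1[where 'p='p] by (simp add: residues_def one_less_power)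

lemma padic_residue_in_carrier:
  "padic_residue (x :: 'p::prime_card padic_int) k \<in> carrier (residue_ring (int CARD('p) ^ k))"
  using padic_residue_bounds[of x k] by (simp add: residue_ring_def)

lemma padic_residue_mult_ring:
  "padic_residue (x * y) k =
    padic_residue x k \<otimes>\<^bsub>residue_ring (int CARD('p) ^ k)\<^esub> padic_residue (y :: 'p::prime_card padic_int) k"
  by (simp add: padic_residue_mult residue_ring_def)

lemma padic_residue_add_ring:
  "padic_residue (x + y) k =
    padic_residue x k \<oplus>\<^bsub>residue_ring (int CARD('p) ^ k)\<^esub> padic_residue (y :: 'p::prime_card padic_int) k"
  by (simp add: padic_residue_add residue_ring_def)

lemma padic_residue_one_ring:
  assumes "1 \<le> k"
  shows "padic_residue (1 :: 'p::prime_card padic_int) k = \<one>\<^bsub>residue_ring (int CARD('p) ^ k)\<^esub>"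
proof -
  interpret residues "int CARD('p) ^ k" "residue_ring (int CARD('p) ^ k)"
    by (rule residues_card_power[OF assms])
  show ?thesis by (simp add: padic_residue_one one_cong)
qed

lemma padic_residue_power_ring:
  assumes "1 \<le> k"
  shows "padic_residue (x ^ n) k =
    padic_residue (x :: 'p::prime_card padic_int) k [^]\<^bsub>residue_ring (int CARD('p) ^ k)\<^esub> n"
proof (induction n)
  case 0
  then show ?case using padic_residue_one_ring[OF assms, where 'p='p] by simp
next
  case (Suc n)
  then show ?case unfolding power_Suc2 padic_residue_mult_ring by simp
qed

lemma padic_residue_unit:
  assumes "1 \<le> k" and "(x :: 'p::prime_card padic_int) dvd 1"
  shows "padic_residue x k \<in> Units (residue_ring (int CARD('p) ^ k))"
proof -
  obtain y where y: "1 = x * y" using assms(2) ..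
  have "padic_residue x k \<otimes>\<^bsub>residue_ring (int CARD('p) ^ k)\<^esub> padic_residue y k = \<one>\<^bsub>residue_ring (int CARD('p) ^ k)\<^esub>"
    "padic_residue y k \<otimes>\<^bsub>residue_ring (int CARD('p) ^ k)\<^esub> padic_residue x k = \<one>\<^bsub>residue_ring (int CARD('p) ^ k)\<^esub>"
    using y by (simp_all add: padic_residue_one_ring[OF assms(1), symmetric] mult.commute flip: padic_residue_mult_ring)
  then show ?thesis
    unfolding Units_def using padic_residue_in_carrier by blast
qed

lemma padic_residue_eq_iff:
  "padic_residue x k = padic_residue y k \<longleftrightarrow> of_nat CARD('p) ^ k dvd (x - y :: 'p::prime_card padic_int)"
proof -
  have "padic_residue x k = padic_residue y k \<longleftrightarrow>
      padic_residue x k mod int CARD('p) ^ k = padic_residue y k mod int CARD('p) ^ k"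
    by simp
  also have "\<dots> \<longleftrightarrow> padic_residue (x - y) k = 0"
    unfolding padic_residue_diff by (simp add: mod_eq_dvd_iff dvd_eq_mod_eq_0 del: padic_residue_mod_self)
  finally show ?thesis by (simp add: power_dvd_iff_residue)
qed

text \<open>The last coordinate of an admissible scaling is \<open>- v\<close>, where \<open>v\<close> is the scaling factor. So \<open>v\<close> is integral
  and divides all three coordinates, hence is a unit, and its residue scales the reduced point.\<close>

lemma reduce_point_eq:
  fixes w t :: "'p::prime_card padic_int"
  assumes k: "1 \<le> k"
  shows "reduce_point k (proj_point ring_of_type_algebra (to_fract w, to_fract t, - 1)) =
    proj_point (residue_ring (int CARD('p) ^ k)) (padic_residue w k, padic_residue t k, padic_residue (- 1 :: 'p padic_int) k)"
proof -
  let ?pt = "\<lambda>Z X Y :: 'p padic_int. proj_point (residue_ring (int CARD('p) ^ k))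
    (padic_residue Z k, padic_residue X k, padic_residue Y k)"
  let ?P = "proj_point ring_of_type_algebra (to_fract w, to_fract t, - 1)"
  interpret residues "int CARD('p) ^ k" "residue_ring (int CARD('p) ^ k)"
    by (rule residues_card_power[OF k])
  have "?pt Z X Y = ?pt w t (- 1)"
    if P: "(to_fract Z, to_fract X, to_fract Y) \<in> ?P" and unit: "Z dvd 1 \<or> X dvd 1 \<or> Y dvd 1" for Z X Y
  proof -
    obtain u where u: "to_fract Z = u * to_fract w" "to_fract X = u * to_fract t" "to_fract Y = u * - 1"
      using P unfolding mem_proj_point_field by blast
    define v where "v = - Y"
    have "u = to_fract v" using u(3) by (simp add: v_def)
    then have v: "Z = v * w" "X = v * t" "Y = v * (- 1)"
      using u(1,2) by (simp_all only: to_fract_mult[symmetric] to_fract_eq_iff) (simp add: v_def)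
    then have "v dvd 1" using unit by (metis dvd_mult_left)
    then have "padic_residue v k \<in> Units (residue_ring (int CARD('p) ^ k))"
      by (rule padic_residue_unit[OF k])
    then show ?thesis
      unfolding v padic_residue_mult_ring
      by (intro proj_point_scale monoid_axioms padic_residue_in_carrier)
  qed
  moreover have "(to_fract w, to_fract t, to_fract (- 1)) \<in> ?P \<and> (w dvd 1 \<or> t dvd 1 \<or> (- 1 :: 'p padic_int) dvd 1)"
    unfolding mem_proj_point_field by (intro conjI exI[of _ 1]) simp_all
  ultimately have "{?pt Z X Y | Z X Y. (to_fract Z, to_fract X, to_fract Y) \<in> ?P \<and> (Z dvd 1 \<or> X dvd 1 \<or> Y dvd 1)} =
      {?pt w t (- 1)}"
    by blast
  then show ?thesis
    unfolding reduce_point_def by (simp only: the_elem_eq)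
qed

lemma curve_point_mem_weierstrass_points:
  fixes a b w t :: "'p::prime_card padic_int"
  assumes k: "1 \<le> k" and curve: "w = t ^ 3 + a * t * w ^ 2 + b * w ^ 3"
  shows "proj_point (residue_ring (int CARD('p) ^ k)) (padic_residue w k, padic_residue t k, padic_residue (- 1 :: 'p padic_int) k)
    \<in> weierstrass_points (residue_ring (int CARD('p) ^ k)) (padic_residue a k) (padic_residue b k)"
proof -
  have "padic_residue ((- 1) ^ 2 * w) k = padic_residue (t ^ 3 + a * t * w ^ 2 + b * w ^ 3) k"
    using curve by simp
  moreover have "padic_residue (- 1 :: 'p padic_int) k \<in> Units (residue_ring (int CARD('p) ^ k))"
    by (rule padic_residue_unit[OF k]) simp
  ultimately show ?thesis
    unfolding weierstrass_points_def padic_residue_mult_ring padic_residue_add_ring padic_residue_power_ring[OF k]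
    using padic_residue_in_carrier by blast
qed

section \<open>The logarithm\<close>

theorem theorem4p1:
  fixes p k :: nat and a b :: "'p::prime_card padic_int"
  assumes "Factorial_Ring.prime p" and "p = CARD('p)" and "k \<ge> 1"
    and "nonsingular_weierstrass (to_fract a) (to_fract b)"
    and "nonsingular_weierstrass (reduce_mod_p a) (reduce_mod_p b)"
  shows "Exp a b k \<in> pZp_quotient k \<rightarrow>
           weierstrass_points (residue_ring (int p ^ k)) (padic_residue a k) (padic_residue b k) \<and>
         (\<exists>Log. Log \<in> Exp a b k ` pZp_quotient k \<rightarrow> pZp_quotient k \<and>
           (\<forall>C \<in> pZp_quotient k. Log (Exp a b k C) = C) \<and>
           (\<forall>R \<in> Exp a b k ` pZp_quotient k. Exp a b k (Log R) = R))"
proof -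
  have odd: "3 \<le> CARD('p)"
    using assms(5) by (rule nonsingular_weierstrass_imp_odd)
  let ?R = "residue_ring (int CARD('p) ^ k)"
  interpret residues "int CARD('p) ^ k" ?R
    by (rule residues_card_power[OF assms(3)])
  have "\<forall>x. \<exists>w t s. of_nat CARD('p) dvd x \<longrightarrow>
      evaluates_to (padic_rate TYPE('p)) (t_scaled (to_fract a) (to_fract b)) (to_fract x) s \<and>
      to_fract t = to_fract x * s \<and> of_nat CARD('p) dvd w \<and> w = t ^ 3 + a * t * w ^ 2 + b * w ^ 3 \<and>
      exp_point a b x = proj_point ring_of_type_algebra (to_fract w, to_fract t, - 1)"
    by (metis exp_point_coordinates[OF odd])
  then obtain w t s where coord: "\<And>x. of_nat CARD('p) dvd x \<Longrightarrow>
      evaluates_to (padic_rate TYPE('p)) (t_scaled (to_fract a) (to_fract b)) (to_fract x) (s x) \<and>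
      to_fract (t x) = to_fract x * s x \<and> of_nat CARD('p) dvd w x \<and>
      w x = t x ^ 3 + a * t x * w x ^ 2 + b * w x ^ 3 \<and>
      exp_point a b x = proj_point ring_of_type_algebra (to_fract (w x), to_fract (t x), - 1)"
    by metis
  define pt where "pt x = proj_point ?R (padic_residue (w x) k, padic_residue (t x) k, padic_residue (- 1 :: 'p padic_int) k)" for x
  have reduce: "reduce_point k (exp_point a b x) = pt x" if "of_nat CARD('p) dvd x" for x
    using coord[OF that] reduce_point_eq[OF assms(3), of "w x" "t x"] by (simp only: pt_def)
  have pt_eq_iff: "pt x = pt y \<longleftrightarrow> of_nat CARD('p) ^ k dvd x - y"
    if x: "of_nat CARD('p) dvd x" and y: "of_nat CARD('p) dvd y" for x y
  proof -
    have "vabs (t x - t y) = vabs (x - y)"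
      using coord[OF x] coord[OF y] by (intro exp_coordinate_isometry[OF odd x y]) blast+
    then have iff: "of_nat CARD('p) ^ k dvd t x - t y \<longleftrightarrow> of_nat CARD('p) ^ k dvd x - y"
      by (simp only: power_dvd_iff_residue flip: vabs_le_iff_residue)
    show ?thesis
    proof
      assume eq: "pt x = pt y"
      have "padic_residue (- 1 :: 'p padic_int) k \<in> Units ?R"
        by (rule padic_residue_unit[OF assms(3)]) simp
      then have "padic_residue (t x) k = padic_residue (t y) k"
        using proj_point_eq_imp[OF monoid_axioms eq[unfolded pt_def]] padic_residue_in_carrier by blast
      then show "of_nat CARD('p) ^ k dvd x - y"
        by (simp only: padic_residue_eq_iff iff)
    next
      assume "of_nat CARD('p) ^ k dvd x - y"
      then have t: "of_nat CARD('p) ^ k dvd t x - t y" by (simp only: iff)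
      then have "of_nat CARD('p) ^ k dvd w x - w y"
        using coord[OF x] coord[OF y] by (intro curve_congruence[of "w x" "t x" a b "w y" "t y"]) blast+
      then show "pt x = pt y"
        using t by (simp add: pt_def padic_residue_eq_iff[symmetric])
    qed
  qed
  have classes: "\<exists>x. of_nat CARD('p) dvd x \<and> C = {y. of_nat CARD('p) ^ k dvd x - y} \<and> Exp a b k C = pt x"
    if C: "C \<in> pZp_quotient k" for C
  proof -
    obtain x where x: "of_nat CARD('p) dvd x" and C: "C = {y. of_nat CARD('p) ^ k dvd x - y}"
      using C by (auto simp: pZp_quotient_def elim!: quotientE)
    have "reduce_point k (exp_point a b y) = pt x" if "y \<in> C" for y
    proof -
      have xy: "of_nat CARD('p) ^ k dvd x - y" using that C by simp
      have "of_nat CARD('p) ^ 1 dvd (of_nat CARD('p) ^ k :: 'p padic_int)"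
        by (rule le_imp_power_dvd[OF assms(3)])
      then have "of_nat CARD('p) dvd x - y"
        using xy by (metis dvd_trans power_one_right)
      then have "of_nat CARD('p) dvd x - (x - y)"
        using x by (rule dvd_diff[rotated])
      then have y: "of_nat CARD('p) dvd y" by simp
      show ?thesis
        using pt_eq_iff[OF x y] xy reduce[OF y] by simp
    qed
    moreover have "x \<in> C" by (simp add: C)
    ultimately have "(\<lambda>z. reduce_point k (exp_point a b z)) ` C = {pt x}" by blast
    then have "Exp a b k C = pt x"
      unfolding Exp_def by (simp only: the_elem_eq)
    then show ?thesis using x C by blast
  qed
  have inj: "inj_on (Exp a b k) (pZp_quotient k)"
  proof (rule inj_onI)
    fix C D :: "'p padic_int set"
    assume CD: "C \<in> pZp_quotient k" "D \<in> pZp_quotient k" and eq: "Exp a b k C = Exp a b k D"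
    obtain x where x: "of_nat CARD('p) dvd x" "C = {y. of_nat CARD('p) ^ k dvd x - y}" "Exp a b k C = pt x"
      using classes[OF CD(1)] by blast
    obtain y where y: "of_nat CARD('p) dvd y" "D = {z. of_nat CARD('p) ^ k dvd y - z}" "Exp a b k D = pt y"
      using classes[OF CD(2)] by blast
    have xy: "of_nat CARD('p) ^ k dvd x - y"
      using pt_eq_iff[OF x(1) y(1)] eq x(3) y(3) by simp
    have "of_nat CARD('p) ^ k dvd x - z \<longleftrightarrow> of_nat CARD('p) ^ k dvd y - z" for z
      using dvd_add_right_iff[OF xy, of "y - z"] by simp
    then show "C = D" by (simp add: x(2) y(2))
  qed
  have "Exp a b k \<in> pZp_quotient k \<rightarrow> weierstrass_points ?R (padic_residue a k) (padic_residue b k)"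
  proof
    fix C :: "'p padic_int set" assume "C \<in> pZp_quotient k"
    then obtain x where x: "of_nat CARD('p) dvd x" "Exp a b k C = pt x"
      using classes by blast
    show "Exp a b k C \<in> weierstrass_points ?R (padic_residue a k) (padic_residue b k)"
      unfolding x(2) pt_def using coord[OF x(1)] by (intro curve_point_mem_weierstrass_points[OF assms(3)]) blast
  qed
  moreover have "inv_into (pZp_quotient k) (Exp a b k) \<in> Exp a b k ` pZp_quotient k \<rightarrow> pZp_quotient k"
    by (rule Pi_I) (rule inv_into_into)
  moreover have "\<forall>C \<in> pZp_quotient k. inv_into (pZp_quotient k) (Exp a b k) (Exp a b k C) = C"
    by (intro ballI inv_into_f_f inj)
  moreover have "\<forall>R \<in> Exp a b k ` pZp_quotient k. Exp a b k (inv_into (pZp_quotient k) (Exp a b k) R) = R"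
    by (intro ballI f_inv_into_f)
  ultimately show ?thesis
    unfolding assms(2) by (intro conjI exI[of _ "inv_into (pZp_quotient k) (Exp a b k)"])
qed

end
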